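(* Let $\mathsf{NQ.L}$ be any properly closed nested calculus. The following rules of internal and external weakening are height-preserving admissible in $\mathsf{NQ.L}$ (for every one-hole context $\mathcal S\{\cdot\}$, signatures $X,Y$ and multisets of formulas $\Gamma,\Delta,\Pi,\Sigma$): $$\dfrac{\mathcal S\{X;\Gamma\Rightarrow\Delta\}}{\mathcal S\{X;\Pi,\Gamma\Rightarrow\Delta,\Sigma\}}\;(IW)\qquad\dfrac{\mathcal S\{X;\Gamma\Rightarrow\Delta\}}{\mathcal S\{X;\Gamma\Rightarrow\Delta,[Y;\Pi\Rightarrow\Sigma]\}}\;(EW)$$
   Context: **Language.** Fix, for each $n$, an at most countable set of $n$-ary predicates $R^n_i$, and a denumerable set of variables. Formulas of $\mathcal L$: $A::=R_i^n(x_1,\dots,x_n)\mid x_1=x_2\mid\bot\mid A\supset A\mid\forall xA\mid\Box A$. Atomic formulas are those of shape $R_i^n(x_1,\dots,x_n)$ or $x_1=x_2$. $A(y/x)$ is capture-avoiding substitution (renaming bound variables if needed). **Axiom sets.** A frame is $\langle\mathcal W,\mathcal R,\mathcal D\rangle$ with $\mathcal W\neq\varnothing$, $\mathcal R\subseteq\mathcal W^2$, and $\mathcal D$ assigning to each $w\in\mathcal W$ a possibly empty set $\mathcal D_w$, with $\mathcal D_v\ne\varnothing$ for some $v$. Axiom names correspond to frame properties: $\mathbf D$: $\mathcal R$ serial; $\mathbf T$: reflexive; $\mathbf B$: symmetric; $\mathbf 4$: transitive; $\mathbf 5$: Euclidean ($w\mathcal Rv$ and $w\mathcal Ru$ imply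 $v\mathcal Ru$); $\mathbf{CBF}$: $w\mathcal Rv$ implies $\mathcal D_w\subseteq\mathcal D_v$; $\mathbf{BF}$: $w\mathcal Rv$ implies $\mathcal D_w\supseteq\mathcal D_v$; $\mathbf{UI}$: $\mathcal D_w=\mathcal D_v$ for all $w,v$. For $\mathsf L\subseteq\{\mathbf D,\mathbf T,\mathbf B,\mathbf 4,\mathbf 5,\mathbf{CBF},\mathbf{BF},\mathbf{UI}\}$, a $\mathsf{Q.L}$-frame is a frame with the properties of all members of $\mathsf L$. $\mathsf L$ is properly closed iff for every $Z\in\{\mathbf 4,\mathbf 5,\mathbf{CBF},\mathbf{BF}\}$, if all $\mathsf{Q.L}$-frames have the property of $Z$, then $Z\in\mathsf L$. **Nested sequents.** A sequent is $X;\Gamma\Rightarrow\Delta$ with $X$ (the signature) a finite multiset of variables and $\Gamma,\Delta$ finite multisets of formulas (an omitted signature is empty). A nested sequent is $X;\Gamma\Rightarrow\Delta,[\mathcal S_1],\dots,[\mathcal S_n]$ with $\mathcal S_i$ nested sequents: a finite tree of sequents with root $X;\Gamma\Rightarrow\Delta$ and the $\mathcal S_i$ as immediate subtrees (order irrelevant). A context $\mathcal S\{\cdot\}\cdots\{\cdot\}$ is a nested sequent with finitely many holes, each located at some node, in arbitrary relative positions (several holes may be at one node). Plugging $Y;\Pi\Rightarrow\Sigma,[\mathcal S'_1],\dots,[\mathcal S_k']$ into a hole at a node adds $Y,\Pi,\Sigma$ to the signature, antecedent, succedent of that node (multiset union) and adds the $\mathcal S'_j$ as further children; plugging $\emptyset$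 removes the hole. The depth of a hole is the distance of its node from the root. When a bracketed component $[Y;\Pi\Rightarrow\Sigma]$ is displayed in both premiss and conclusion of a rule, that node may have further children, which stay attached to it; components displayed as newly created are leaves. **Rules** (premisses / conclusion). $\mathsf{NQ.K}$ consists of: - Initial sequents $\mathcal S\{X;P,\Gamma\Rightarrow\Delta,P\}$, $P$ atomic; and $L\bot$: $\mathcal S\{X;\bot,\Gamma\Rightarrow\Delta\}$ (no premisses). - $L{\supset}$: $\mathcal S\{X;\Gamma\Rightarrow\Delta,A\}$ and $\mathcal S\{X;B,\Gamma\Rightarrow\Delta\}$ / $\mathcal S\{X;A\supset B,\Gamma\Rightarrow\Delta\}$. $R{\supset}$: $\mathcal S\{X;A,\Gamma\Rightarrow\Delta,B\}$ / $\mathcal S\{X;\Gamma\Rightarrow\Delta,A\supset B\}$. - $L\forall$: $\mathcal S\{X,z;A(z/x),\forall xA,\Gamma\Rightarrow\Delta\}$ / $\mathcal S\{X,z;\forall xA,\Gamma\Rightarrow\Delta\}$. $R\forall$: $\mathcal S\{X,y;\Gamma\Rightarrow\Delta,A(y/x)\}$ / $\mathcal S\{X;\Gamma\Rightarrow\Delta,\forall xA\}$, $y$ (the eigenvariable) fresh, i.e. not occurring in the conclusion. - $L\Box$: $\mathcal S\{X;\Box A,\Gamma\Rightarrow\Delta,[Y;A,\Pi\Rightarrow\Sigma]\}$ / $\mathcal S\{X;\Box A,\Gamma\Rightarrow\Delta,[Y;\Pi\Rightarrow\Sigma]\}$. $R\Box$: $\mathcal S\{X;\Gamma\Rightarrow\Delta,[\emptyset;\Rightarrow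 A]\}$ / $\mathcal S\{X;\Gamma\Rightarrow\Delta,\Box A\}$. - $Ref$: $\mathcal S\{X;x=x,\Gamma\Rightarrow\Delta\}$ / $\mathcal S\{X;\Gamma\Rightarrow\Delta\}$. $Repl$ ($P$ atomic): $\mathcal S\{X;P(y/z),x=y,P(x/z),\Gamma\Rightarrow\Delta\}$ / $\mathcal S\{X;x=y,P(x/z),\Gamma\Rightarrow\Delta\}$. $Repl_X$: $\mathcal S\{X,x,y;x=y,\Gamma\Rightarrow\Delta\}$ / $\mathcal S\{X,x;x=y,\Gamma\Rightarrow\Delta\}$. $Rig$: $\mathcal S\{X;x=y,\Gamma\Rightarrow\Delta\}\{Y;x=y,\Pi\Rightarrow\Sigma\}$ / $\mathcal S\{X;x=y,\Gamma\Rightarrow\Delta\}\{Y;\Pi\Rightarrow\Sigma\}$. $\mathsf{NQ.L}$ adds the rule of each member of $\mathsf L$: - $R_D$ ($\mathbf D$): $\mathcal S\{X;\Gamma\Rightarrow\Delta,[\emptyset;\Rightarrow]\}$ / $\mathcal S\{X;\Gamma\Rightarrow\Delta\}$. $R_T$ ($\mathbf T$): $\mathcal S\{X;A,\Box A,\Gamma\Rightarrow\Delta\}$ / $\mathcal S\{X;\Box A,\Gamma\Rightarrow\Delta\}$. $R_B$ ($\mathbf B$): $\mathcal S\{X;A,\Gamma\Rightarrow\Delta,[Y;\Box A,\Pi\Rightarrow\Sigma]\}$ / $\mathcal S\{X;\Gamma\Rightarrow\Delta,[Y;\Box A,\Pi\Rightarrow\Sigma]\}$. $R_4$ ($\mathbf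 4$): $\mathcal S\{X;\Box A,\Gamma\Rightarrow\Delta,[Y;\Box A,\Pi\Rightarrow\Sigma]\}$ / $\mathcal S\{X;\Box A,\Gamma\Rightarrow\Delta,[Y;\Pi\Rightarrow\Sigma]\}$. $R_5$ ($\mathbf 5$): $\mathcal S\{X;\Box A,\Gamma\Rightarrow\Delta\}\{Y;\Box A,\Pi\Rightarrow\Sigma\}$ / $\mathcal S\{X;\Box A,\Gamma\Rightarrow\Delta\}\{Y;\Pi\Rightarrow\Sigma\}$, first hole of depth $\ge1$. - $R_{cbf}$ ($\mathbf{CBF}$): $\mathcal S\{X,x;\Gamma\Rightarrow\Delta,[Y,x;\Pi\Rightarrow\Sigma]\}$ / $\mathcal S\{X,x;\Gamma\Rightarrow\Delta,[Y;\Pi\Rightarrow\Sigma]\}$. $R_{bf}$ ($\mathbf{BF}$): $\mathcal S\{X,x;\Gamma\Rightarrow\Delta,[Y,x;\Pi\Rightarrow\Sigma]\}$ / $\mathcal S\{X;\Gamma\Rightarrow\Delta,[Y,x;\Pi\Rightarrow\Sigma]\}$. $R_{ui}$ ($\mathbf{UI}$): $\mathcal S\{X,x;\Gamma\Rightarrow\Delta\}$ / $\mathcal S\{X;\Gamma\Rightarrow\Delta\}$. - $R_{5dom}$: $\mathcal S\{X,x;\Gamma\Rightarrow\Delta\}\{Y,x;\Pi\Rightarrow\Sigma\}$ / $\mathcal S\{X,x;\Gamma\Rightarrow\Delta\}\{Y;\Pi\Rightarrow\Sigma\}$, both holes of depth $\ge1$; it is a rule of $\mathsf{NQ.L}$ iff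 $\mathbf 5\in\mathsf L$ and $\{\mathbf{CBF},\mathbf{BF}\}\cap\mathsf L\ne\emptyset$. $\mathsf{NQ.L}$ is properly closed iff $\mathsf L$ is properly closed and $R_{5dom}$ is included exactly as just stated. **Derivations.** An $\mathsf{NQ.L}$-derivation of $\mathcal S$ is a finite tree of nested sequents with root $\mathcal S$, built by the rules, with leaves initial sequents (or instances of $L\bot$). Only derivations of pure sequents are considered: no variable occurs both free and bound, and eigenvariables are pairwise distinct. Height is the number of nodes on a longest branch. $\mathcal S$ is derivable iff $\mathcal S$ or an alphabetical variant (bound renaming) of it has a derivation. A rule is height-preserving admissible if whenever its premisses are derivable with height at most $n$, so is its conclusion. *)

theory Defs
  imports "HOL-Library.Multiset" "HOL-Library.Countable_Set"
begin

section \<open>Formulas\<close>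

type_synonym var = nat

text \<open>
  \<open>Rel i [x\<^sub>1, \<dots>, x\<^sub>n]\<close> stands for the atom built from the \<open>i\<close>-th \<open>n\<close>-ary predicate.
  A language is a family \<open>I\<close> of index sets: the \<open>i\<close>-th \<open>n\<close>-ary predicate exists iff
  \<open>i \<in> I n\<close>, so every \<open>n\<close> has an arbitrary, at most countable (possibly empty) set of
  predicates.
\<close>

datatype fm =
    Rel nat "var list"
  | Eq var var
  | Bot
  | Imp fm fm
  | All var fm
  | Box fm

primrec in_lang_fm :: "(nat \<Rightarrow> nat set) \<Rightarrow> fm \<Rightarrow> bool" where
  "in_lang_fm I (Rel i xs) \<longleftrightarrow> i \<in> I (length xs)"
| "in_lang_fm I (Eq x y) \<longleftrightarrow> True"
| "in_lang_fm I Bot \<longleftrightarrow> True"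
| "in_lang_fm I (Imp A B) \<longleftrightarrow> in_lang_fm I A \<and> in_lang_fm I B"
| "in_lang_fm I (All x A) \<longleftrightarrow> in_lang_fm I A"
| "in_lang_fm I (Box A) \<longleftrightarrow> in_lang_fm I A"

primrec atomic :: "fm \<Rightarrow> bool" where
  "atomic (Rel i xs) \<longleftrightarrow> True"
| "atomic (Eq x y) \<longleftrightarrow> True"
| "atomic Bot \<longleftrightarrow> False"
| "atomic (Imp A B) \<longleftrightarrow> False"
| "atomic (All x A) \<longleftrightarrow> False"
| "atomic (Box A) \<longleftrightarrow> False"

primrec fv :: "fm \<Rightarrow> var set" where
  "fv (Rel i xs) = set xs"
| "fv (Eq x y) = {x, y}"
| "fv Bot = {}"
| "fv (Imp A B) = fv A \<union> fv B"
| "fv (All x A) = fv A - {x}"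
| "fv (Box A) = fv A"

primrec bv :: "fm \<Rightarrow> var set" where
  "bv (Rel i xs) = {}"
| "bv (Eq x y) = {}"
| "bv Bot = {}"
| "bv (Imp A B) = bv A \<union> bv B"
| "bv (All x A) = insert x (bv A)"
| "bv (Box A) = bv A"

text \<open>
  Capture-avoiding simultaneous substitution of variables for free variables. A bound variable
  is renamed exactly when it would capture something.
\<close>

primrec substs :: "fm \<Rightarrow> (var \<Rightarrow> var) \<Rightarrow> fm" where
  "substs (Rel i xs) s = Rel i (map s xs)"
| "substs (Eq x y) s = Eq (s x) (s y)"
| "substs Bot s = Bot"
| "substs (Imp A B) s = Imp (substs A s) (substs B s)"
| "substs (All x A) s =
     (let F = s ` (fv A - {x});
          z = (if x \<in> F then (LEAST z. z \<notin> F) else x)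
      in All z (substs A (s(x := z))))"
| "substs (Box A) s = Box (substs A s)"

text \<open>\<open>subst A y x\<close> is \<open>A(y/x)\<close>.\<close>

definition subst :: "fm \<Rightarrow> var \<Rightarrow> var \<Rightarrow> fm" where
  "subst A y x = substs A (id(x := y))"

text \<open>Bound renaming: the least congruence that renames single quantifiers.\<close>

inductive alpha :: "fm \<Rightarrow> fm \<Rightarrow> bool" where
  alpha_refl: "alpha A A"
| alpha_sym: "alpha A B \<Longrightarrow> alpha B A"
| alpha_trans: "alpha A B \<Longrightarrow> alpha B C \<Longrightarrow> alpha A C"
| alpha_Imp: "alpha A A' \<Longrightarrow> alpha B B' \<Longrightarrow> alpha (Imp A B) (Imp A' B')"
| alpha_All: "alpha A A' \<Longrightarrow> alpha (All x A) (All x A')"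
| alpha_Box: "alpha A A' \<Longrightarrow> alpha (Box A) (Box A')"
| alpha_rename: "y \<notin> fv A \<Longrightarrow> alpha (All x A) (All y (subst A y x))"


section \<open>Frames and properly closed sets of axioms\<close>

datatype ax = AxD | AxT | AxB | Ax4 | Ax5 | AxCBF | AxBF | AxUI

record ('w, 'd) frame =
  worlds :: "'w set"
  acc :: "('w \<times> 'w) set"
  indivs :: "'w \<Rightarrow> 'd set"

definition is_frame :: "('w, 'd) frame \<Rightarrow> bool" where
  "is_frame F \<longleftrightarrow> worlds F \<noteq> {} \<and> acc F \<subseteq> worlds F \<times> worlds F \<and>
     (\<exists>v \<in> worlds F. indivs F v \<noteq> {})"

primrec has_prop :: "('w, 'd) frame \<Rightarrow> ax \<Rightarrow> bool" where
  "has_prop F AxD \<longleftrightarrow> (\<forall>w \<in> worlds F. \<exists>v. (w, v) \<in> acc F)"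
| "has_prop F AxT \<longleftrightarrow> refl_on (worlds F) (acc F)"
| "has_prop F AxB \<longleftrightarrow> sym (acc F)"
| "has_prop F Ax4 \<longleftrightarrow> trans (acc F)"
| "has_prop F Ax5 \<longleftrightarrow> (\<forall>w v u. (w, v) \<in> acc F \<longrightarrow> (w, u) \<in> acc F \<longrightarrow> (v, u) \<in> acc F)"
| "has_prop F AxCBF \<longleftrightarrow> (\<forall>w v. (w, v) \<in> acc F \<longrightarrow> indivs F w \<subseteq> indivs F v)"
| "has_prop F AxBF \<longleftrightarrow> (\<forall>w v. (w, v) \<in> acc F \<longrightarrow> indivs F w \<supseteq> indivs F v)"
| "has_prop F AxUI \<longleftrightarrow> (\<forall>w \<in> worlds F. \<forall>v \<in> worlds F. indivs F w = indivs F v)"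

definition QL_frame :: "ax set \<Rightarrow> ('w, 'd) frame \<Rightarrow> bool" where
  "QL_frame L F \<longleftrightarrow> is_frame F \<and> (\<forall>Z \<in> L. has_prop F Z)"

text \<open>
  A definition cannot quantify over all types of worlds and individuals. By
  \<open>nat_frames_suffice\<close> below, frames over the natural numbers are representative.
\<close>

definition properly_closed :: "ax set \<Rightarrow> bool" where
  "properly_closed L \<longleftrightarrow>
     (\<forall>Z \<in> {Ax4, Ax5, AxCBF, AxBF}.
        (\<forall>F :: (nat, nat) frame. QL_frame L F \<longrightarrow> has_prop F Z) \<longrightarrow> Z \<in> L)"

lemma nat_frames_suffice:
  fixes F :: "('w, 'd) frame"
  assumes Z: "Z \<in> {Ax4, Ax5, AxCBF, AxBF}"
    and nat: "\<forall>F :: (nat, nat) frame. QL_frame L F \<longrightarrow> has_prop F Z"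
    and F: "QL_frame L F"
  shows "has_prop F Z"
proof (rule ccontr)
  assume neg: "\<not> has_prop F Z"
  let ?W = "worlds F" and ?R = "acc F" and ?D = "indivs F"
  have R: "a \<in> ?W \<and> b \<in> ?W" if "(a, b) \<in> ?R" for a b
    using F that by (auto simp: QL_frame_def is_frame_def)
  obtain v e where ve: "v \<in> ?W" "e \<in> ?D v"
    using F by (auto simp: QL_frame_def is_frame_def)
  obtain a b c d where abc: "a \<in> ?W" "b \<in> ?W" "c \<in> ?W"
    and bad: "Z = Ax4 \<and> (a, b) \<in> ?R \<and> (b, c) \<in> ?R \<and> (a, c) \<notin> ?R \<or>
      Z = Ax5 \<and> (a, b) \<in> ?R \<and> (a, c) \<in> ?R \<and> (b, c) \<notin> ?R \<or>
      Z = AxCBF \<and> (a, b) \<in> ?R \<and> d \<in> ?D a \<and> d \<notin> ?D b \<or>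
      Z = AxBF \<and> (a, b) \<in> ?R \<and> d \<notin> ?D a \<and> d \<in> ?D b"
    using Z neg R by (auto simp: trans_def) blast+
  define s where "s w = (if \<exists>u. (w, u) \<in> ?R then SOME u. (w, u) \<in> ?R else w)" for w
  have s: "(w, s w) \<in> ?R" if "(w, u) \<in> ?R" for w u
    unfolding s_def using that by (auto intro: someI)
  have sW: "s w \<in> ?W" if "w \<in> ?W" for w
  proof (cases "\<exists>u. (w, u) \<in> ?R")
    case True
    then show ?thesis using s R by blast
  next
    case False
    then show ?thesis using that by (simp add: s_def)
  qed
  define V where "V = (\<Union>n. (s ^^ n) ` {a, b, c, v})"
  have V0: "a \<in> V" "b \<in> V" "c \<in> V" "v \<in> V"
    unfolding V_def by (auto intro!: exI[of _ 0])
  have "(s ^^ n) w \<in> ?W" if "w \<in> ?W" for n w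
    using that sW by (induction n) auto
  then have VW: "w \<in> ?W" if "w \<in> V" for w
    using that abc ve(1) unfolding V_def by blast
  have sV: "s w \<in> V" if "w \<in> V" for w
  proof -
    from that obtain n u where "u \<in> {a, b, c, v}" "w = (s ^^ n) u"
      unfolding V_def by blast
    then have "s w = (s ^^ Suc n) u" "u \<in> {a, b, c, v}" by auto
    then show ?thesis unfolding V_def by blast
  qed
  have "countable V" unfolding V_def by auto
  then obtain f :: "'w \<Rightarrow> nat" where f: "inj_on f V" unfolding countable_def by blast
  define h where "h = inv_into V f"
  have h: "h (f w) = w" if "w \<in> V" for w using f that by (simp add: h_def)
  have "countable {d, e}" by simp
  then obtain g :: "'d \<Rightarrow> nat" where g: "inj_on g {d, e}" unfolding countable_def by blast
  define N :: "(nat, nat) frame" where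
    "N = \<lparr>worlds = f ` V,
          acc = {(m, n). m \<in> f ` V \<and> n \<in> f ` V \<and> (h m, h n) \<in> ?R},
          indivs = \<lambda>m. g ` (?D (h m) \<inter> {d, e})\<rparr>"
  have "is_frame N"
    using V0 ve h by (auto simp: is_frame_def N_def)
  moreover have "has_prop N Y" if "Y \<in> L" for Y
  proof -
    have Y: "has_prop F Y" using F that by (simp add: QL_frame_def)
    show ?thesis
    proof (cases Y)
      case AxD
      have "(w, s w) \<in> ?R \<and> s w \<in> V" if "w \<in> V" for w
        using Y that VW s sV unfolding AxD has_prop.simps by blast
      then have "(f w, f (s w)) \<in> acc N" if "w \<in> V" for w
        using that h by (simp add: N_def)
      then have "\<exists>n. (m, n) \<in> acc N" if "m \<in> f ` V" for m
        using that by blast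
      then show ?thesis unfolding AxD has_prop.simps by (simp add: N_def)
    next
      case AxT
      then show ?thesis using Y h VW by (auto simp: N_def refl_on_def)
    next
      case AxB
      then show ?thesis using Y by (auto simp: N_def sym_def)
    next
      case Ax4
      then show ?thesis using Y unfolding has_prop.simps Ax4 trans_def N_def by simp blast
    next
      case Ax5
      then show ?thesis using Y unfolding has_prop.simps Ax5 N_def by simp blast
    next
      case AxCBF
      then show ?thesis using Y unfolding has_prop.simps AxCBF N_def by simp blast
    next
      case AxBF
      then show ?thesis using Y unfolding has_prop.simps AxBF N_def by simp blast
    next
      case AxUI
      have "indivs N (f w) = indivs N (f u)" if "w \<in> V" "u \<in> V" for w u
      proof -
        have "?D w = ?D u" using Y VW that unfolding AxUI has_prop.simps by blast
        with h that show ?thesis unfolding N_def frame.simps by (simp only:)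
      qed
      then have "\<forall>m \<in> f ` V. \<forall>n \<in> f ` V. indivs N m = indivs N n" by blast
      moreover have "worlds N = f ` V" by (simp add: N_def)
      ultimately show ?thesis unfolding AxUI has_prop.simps by (simp only:)
    qed
  qed
  ultimately have NZ: "has_prop N Z" using nat by (simp add: QL_frame_def)
  have N_acc: "(f w, f u) \<in> acc N \<longleftrightarrow> (w, u) \<in> ?R" if "w \<in> V" "u \<in> V" for w u
    using that h by (simp add: N_def)
  have N_indivs: "g d \<in> indivs N (f w) \<longleftrightarrow> d \<in> ?D w" if "w \<in> V" for w
    using that h g by (auto simp: N_def inj_on_def)
  from bad show False
  proof (elim disjE)
    assume "Z = Ax4 \<and> (a, b) \<in> ?R \<and> (b, c) \<in> ?R \<and> (a, c) \<notin> ?R"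
    then have "has_prop N Ax4" "(f a, f b) \<in> acc N" "(f b, f c) \<in> acc N" "(f a, f c) \<notin> acc N"
      using NZ N_acc V0 by (simp_all del: has_prop.simps)
    then show False unfolding has_prop.simps by (blast dest: transD)
  next
    assume "Z = Ax5 \<and> (a, b) \<in> ?R \<and> (a, c) \<in> ?R \<and> (b, c) \<notin> ?R"
    then have "has_prop N Ax5" "(f a, f b) \<in> acc N" "(f a, f c) \<in> acc N" "(f b, f c) \<notin> acc N"
      using NZ N_acc V0 by (simp_all del: has_prop.simps)
    then show False unfolding has_prop.simps by blast
  next
    assume "Z = AxCBF \<and> (a, b) \<in> ?R \<and> d \<in> ?D a \<and> d \<notin> ?D b"
    then have "has_prop N AxCBF" "(f a, f b) \<in> acc N"
      "g d \<in> indivs N (f a)" "g d \<notin> indivs N (f b)"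
      using NZ N_acc N_indivs V0 by (simp_all del: has_prop.simps)
    then show False unfolding has_prop.simps by blast
  next
    assume "Z = AxBF \<and> (a, b) \<in> ?R \<and> d \<notin> ?D a \<and> d \<in> ?D b"
    then have "has_prop N AxBF" "(f a, f b) \<in> acc N"
      "g d \<notin> indivs N (f a)" "g d \<in> indivs N (f b)"
      using NZ N_acc N_indivs V0 by (simp_all del: has_prop.simps)
    then show False unfolding has_prop.simps by blast
  qed
qed


section \<open>Nested sequents and contexts\<close>

text \<open>
  \<open>NS X \<Gamma> \<Delta> K\<close> is the node \<open>X; \<Gamma> \<Rightarrow> \<Delta>\<close> with the multiset \<open>K\<close> of immediate subtrees.
\<close>

datatype (sigvars: 'v, fms: 'f) nseq =
  NS (sig: "'v multiset") (ant: "'f multiset") (suc: "'f multiset")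
     (kids: "('v, 'f) nseq multiset")
  for rel: rel_nseq

type_synonym nsequent = "(var, fm) nseq"

definition in_lang :: "(nat \<Rightarrow> nat set) \<Rightarrow> nsequent \<Rightarrow> bool" where
  "in_lang I S \<longleftrightarrow> (\<forall>A \<in> fms S. in_lang_fm I A)"

text \<open>Occurrences in signatures count as free.\<close>

definition free_vars :: "nsequent \<Rightarrow> var set" where
  "free_vars S = sigvars S \<union> (\<Union>A \<in> fms S. fv A)"

definition bound_vars :: "nsequent \<Rightarrow> var set" where
  "bound_vars S = (\<Union>A \<in> fms S. bv A)"

definition pure :: "nsequent \<Rightarrow> bool" where
  "pure S \<longleftrightarrow> free_vars S \<inter> bound_vars S = {}"

definition variant :: "nsequent \<Rightarrow> nsequent \<Rightarrow> bool" where
  "variant S T \<longleftrightarrow> rel_nseq (=) alpha S T"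

text \<open>
  A context is a nested sequent whose nodes additionally carry a multiset of holes, named by
  natural numbers. Hole \<open>i\<close> is filled with the \<open>i\<close>-th element of a list.
\<close>

datatype nctx =
  Ctx "var multiset" "fm multiset" "fm multiset" "nat multiset" "nctx multiset"

text \<open>The names of all holes of a context, each paired with its depth.\<close>

primrec holes :: "nctx \<Rightarrow> (nat \<times> nat) multiset" where
  "holes (Ctx X G D H K) =
     image_mset (\<lambda>h. (h, 0)) H +
     sum_mset (image_mset (image_mset (map_prod id Suc)) (image_mset holes K))"

definition is_ctx :: "nat \<Rightarrow> nctx \<Rightarrow> bool" where
  "is_ctx n C \<longleftrightarrow> image_mset fst (holes C) = mset [0..<n]"

definition depth_ge :: "nctx \<Rightarrow> nat \<Rightarrow> nat \<Rightarrow> bool" where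
  "depth_ge C i k \<longleftrightarrow> (\<forall>d. (i, d) \<in># holes C \<longrightarrow> k \<le> d)"

primrec fill :: "nctx \<Rightarrow> nsequent list \<Rightarrow> nsequent" where
  "fill (Ctx X G D H K) Ss =
     NS (X + (\<Sum>h \<in># H. sig (Ss ! h)))
        (G + (\<Sum>h \<in># H. ant (Ss ! h)))
        (D + (\<Sum>h \<in># H. suc (Ss ! h)))
        ((\<Sum>h \<in># H. kids (Ss ! h)) + image_mset (\<lambda>C. fill C Ss) K)"


section \<open>The calculi\<close>

text \<open>
  \<open>rule L e Ss S\<close>: from the premisses \<open>Ss\<close> infer \<open>S\<close> by a rule of \<open>NQ.L\<close>; \<open>e\<close> is the
  eigenvariable of the inference, if it has one. \<open>K\<close> are the further children of a displayed
  bracketed component; those of the node of a hole belong to the context \<open>C\<close>.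
\<close>

inductive rule :: "ax set \<Rightarrow> var option \<Rightarrow> nsequent list \<Rightarrow> nsequent \<Rightarrow> bool" for L where
  Init: "is_ctx 1 C \<Longrightarrow> atomic P \<Longrightarrow>
    rule L None [] (fill C [NS X ({#P#} + G) (D + {#P#}) {#}])"
| LBot: "is_ctx 1 C \<Longrightarrow>
    rule L None [] (fill C [NS X ({#Bot#} + G) D {#}])"
| LImp: "is_ctx 1 C \<Longrightarrow>
    rule L None
      [fill C [NS X G (D + {#A#}) {#}], fill C [NS X ({#B#} + G) D {#}]]
      (fill C [NS X ({#Imp A B#} + G) D {#}])"
| RImp: "is_ctx 1 C \<Longrightarrow>
    rule L None
      [fill C [NS X ({#A#} + G) (D + {#B#}) {#}]]
      (fill C [NS X G (D + {#Imp A B#}) {#}])"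
| LAll: "is_ctx 1 C \<Longrightarrow>
    rule L None
      [fill C [NS (X + {#z#}) ({#subst A z x, All x A#} + G) D {#}]]
      (fill C [NS (X + {#z#}) ({#All x A#} + G) D {#}])"
| RAll: "is_ctx 1 C \<Longrightarrow> S = fill C [NS X G (D + {#All x A#}) {#}] \<Longrightarrow>
    y \<notin> free_vars S \<union> bound_vars S \<Longrightarrow>
    rule L (Some y)
      [fill C [NS (X + {#y#}) G (D + {#subst A y x#}) {#}]]
      S"
| LBox: "is_ctx 1 C \<Longrightarrow>
    rule L None
      [fill C [NS X ({#Box A#} + G) D {#NS Y ({#A#} + G') D' K#}]]
      (fill C [NS X ({#Box A#} + G) D {#NS Y G' D' K#}])"
| RBox: "is_ctx 1 C \<Longrightarrow>
    rule L None
      [fill C [NS X G D {#NS {#} {#} {#A#} {#}#}]]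
      (fill C [NS X G (D + {#Box A#}) {#}])"
| Ref: "is_ctx 1 C \<Longrightarrow>
    rule L None
      [fill C [NS X ({#Eq x x#} + G) D {#}]]
      (fill C [NS X G D {#}])"
| Repl: "is_ctx 1 C \<Longrightarrow> atomic P \<Longrightarrow>
    rule L None
      [fill C [NS X ({#subst P y z, Eq x y, subst P x z#} + G) D {#}]]
      (fill C [NS X ({#Eq x y, subst P x z#} + G) D {#}])"
| ReplX: "is_ctx 1 C \<Longrightarrow>
    rule L None
      [fill C [NS (X + {#x, y#}) ({#Eq x y#} + G) D {#}]]
      (fill C [NS (X + {#x#}) ({#Eq x y#} + G) D {#}])"
| Rig: "is_ctx 2 C \<Longrightarrow>
    rule L None
      [fill C [NS X ({#Eq x y#} + G) D {#}, NS Y ({#Eq x y#} + G') D' {#}]]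
      (fill C [NS X ({#Eq x y#} + G) D {#}, NS Y G' D' {#}])"
| RD: "AxD \<in> L \<Longrightarrow> is_ctx 1 C \<Longrightarrow>
    rule L None
      [fill C [NS X G D {#NS {#} {#} {#} {#}#}]]
      (fill C [NS X G D {#}])"
| RT: "AxT \<in> L \<Longrightarrow> is_ctx 1 C \<Longrightarrow>
    rule L None
      [fill C [NS X ({#A, Box A#} + G) D {#}]]
      (fill C [NS X ({#Box A#} + G) D {#}])"
| RB: "AxB \<in> L \<Longrightarrow> is_ctx 1 C \<Longrightarrow>
    rule L None
      [fill C [NS X ({#A#} + G) D {#NS Y ({#Box A#} + G') D' K#}]]
      (fill C [NS X G D {#NS Y ({#Box A#} + G') D' K#}])"
| R4: "Ax4 \<in> L \<Longrightarrow> is_ctx 1 C \<Longrightarrow>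
    rule L None
      [fill C [NS X ({#Box A#} + G) D {#NS Y ({#Box A#} + G') D' K#}]]
      (fill C [NS X ({#Box A#} + G) D {#NS Y G' D' K#}])"
| R5: "Ax5 \<in> L \<Longrightarrow> is_ctx 2 C \<Longrightarrow> depth_ge C 0 1 \<Longrightarrow>
    rule L None
      [fill C [NS X ({#Box A#} + G) D {#}, NS Y ({#Box A#} + G') D' {#}]]
      (fill C [NS X ({#Box A#} + G) D {#}, NS Y G' D' {#}])"
| Rcbf: "AxCBF \<in> L \<Longrightarrow> is_ctx 1 C \<Longrightarrow>
    rule L None
      [fill C [NS (X + {#x#}) G D {#NS (Y + {#x#}) G' D' K#}]]
      (fill C [NS (X + {#x#}) G D {#NS Y G' D' K#}])"
| Rbf: "AxBF \<in> L \<Longrightarrow> is_ctx 1 C \<Longrightarrow>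
    rule L None
      [fill C [NS (X + {#x#}) G D {#NS (Y + {#x#}) G' D' K#}]]
      (fill C [NS X G D {#NS (Y + {#x#}) G' D' K#}])"
| Rui: "AxUI \<in> L \<Longrightarrow> is_ctx 1 C \<Longrightarrow>
    rule L None
      [fill C [NS (X + {#x#}) G D {#}]]
      (fill C [NS X G D {#}])"
| R5dom: "Ax5 \<in> L \<Longrightarrow> {AxCBF, AxBF} \<inter> L \<noteq> {} \<Longrightarrow>
    is_ctx 2 C \<Longrightarrow> depth_ge C 0 1 \<Longrightarrow> depth_ge C 1 1 \<Longrightarrow>
    rule L None
      [fill C [NS (X + {#x#}) G D {#}, NS (Y + {#x#}) G' D' {#}]]
      (fill C [NS (X + {#x#}) G D {#}, NS Y G' D' {#}])"

datatype dtree = Inf (concl: nsequent) (eigenvar: "var option") (prems: "dtree list")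

primrec height :: "dtree \<Rightarrow> nat" where
  "height (Inf S e Ds) = Suc (Max (insert 0 (set (map height Ds))))"

primrec sequents :: "dtree \<Rightarrow> nsequent set" where
  "sequents (Inf S e Ds) = insert S (\<Union> (set (map sequents Ds)))"

primrec eigenvars :: "dtree \<Rightarrow> var list" where
  "eigenvars (Inf S e Ds) =
     (case e of None \<Rightarrow> [] | Some y \<Rightarrow> [y]) @ concat (map eigenvars Ds)"

inductive built :: "ax set \<Rightarrow> dtree \<Rightarrow> bool" for L where
  "rule L e (map concl Ds) S \<Longrightarrow> (\<forall>D \<in> set Ds. built L D) \<Longrightarrow> built L (Inf S e Ds)"

definition derivation :: "(nat \<Rightarrow> nat set) \<Rightarrow> ax set \<Rightarrow> dtree \<Rightarrow> nsequent \<Rightarrow> bool" where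
  "derivation I L D S \<longleftrightarrow> concl D = S \<and> built L D \<and>
     (\<forall>T \<in> sequents D. in_lang I T \<and> pure T) \<and> distinct (eigenvars D)"

definition derivable_le :: "(nat \<Rightarrow> nat set) \<Rightarrow> ax set \<Rightarrow> nat \<Rightarrow> nsequent \<Rightarrow> bool" where
  "derivable_le I L n S \<longleftrightarrow>
     (\<exists>S' D. variant S S' \<and> derivation I L D S' \<and> height D \<le> n)"

definition hp_admissible ::
  "(nat \<Rightarrow> nat set) \<Rightarrow> ax set \<Rightarrow> (nsequent list \<Rightarrow> nsequent \<Rightarrow> bool) \<Rightarrow> bool" where
  "hp_admissible I L r \<longleftrightarrow>
     (\<forall>Ss S n. r Ss S \<longrightarrow> (\<forall>T \<in> set (S # Ss). in_lang I T) \<longrightarrow>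
        (\<forall>T \<in> set Ss. derivable_le I L n T) \<longrightarrow> derivable_le I L n S)"

inductive IW :: "nsequent list \<Rightarrow> nsequent \<Rightarrow> bool" where
  "is_ctx 1 C \<Longrightarrow>
    IW [fill C [NS X G D {#}]] (fill C [NS X (P + G) (D + Q) {#}])"

inductive EW :: "nsequent list \<Rightarrow> nsequent \<Rightarrow> bool" where
  "is_ctx 1 C \<Longrightarrow>
    EW [fill C [NS X G D {#}]] (fill C [NS X G D {#NS Y P Q {#}#}])"

end

theory Submission
  imports Defs "HOL-Combinatorics.Transposition"
begin

text \<open>
  Both weakenings are instances of one order on nested sequents, tree embedding with growing
  nodes. Every rule is stable under enlarging its conclusion in this order, so a derivation can
  be enlarged from the root upwards. What must be avoided are clashes of variables: at each
  inference the variables that occur in a premiss but not in the conclusion (eigenvariables, and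
  those introduced by \<open>Ref\<close> and \<open>R\<^sub>u\<^sub>i\<close>) are renamed to fresh ones, by composing an injective
  renaming that is carried upwards with transpositions. Before that, the bound variables of the
  root and of the added formulas are renamed away from all free variables, which leaves a
  variant of the weakened sequent.
\<close>

section \<open>Renaming variables\<close>

text \<open>Purity rules that out: the substituted variable is free in the sequent, fresh, or put
  into an atom, hence never bound in the formula. For the same reason the root's own formulas are
  cleared by one global renaming, which carries the whole derivation along, whereas added formulas
  have no derivation behind them and may be replaced by any variants. Renaming eigenvariables alone
  would not do: a variable brought in by \<open>Ref\<close> or \<open>Rui\<close> may be bound in an
  added formula, and the premiss would be impure. An enlargement must leave the displayed part of a
  rule intact. New material goes into the context, unless it lies inside a displayed bracketed
  child; there it must go into the parameters of the rule. Hence the separate treatment of holes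
  with and without displayed children.\<close>

lemma finite_fv [simp]: "finite (fv A)"
  by (induction A) auto

lemma finite_bv [simp]: "finite (bv A)"
  by (induction A) auto

lemma fv_substs: "fv (substs A s) = s ` fv A"
proof (induction A arbitrary: s)
  case (All x A)
  define F where "F = s ` (fv A - {x})"
  define z where "z = (if x \<in> F then (LEAST z. z \<notin> F) else x)"
  have "finite F" by (simp add: F_def)
  then have "z \<notin> F"
    unfolding z_def by (metis (full_types) LeastI_ex ex_new_if_finite infinite_UNIV_nat)
  moreover have "substs (All x A) s = All z (substs A (s(x := z)))"
    by (simp add: F_def z_def Let_def)
  ultimately show ?case
    by (auto simp: All F_def)
qed auto

lemma fv_subst: "fv (subst A y x) = (fv A - {x}) \<union> (if x \<in> fv A then {y} else {})"
  by (auto simp: subst_def fv_substs)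

lemma in_lang_substs [simp]: "in_lang_fm I (substs A s) = in_lang_fm I A"
  by (induction A arbitrary: s) (auto simp: Let_def)

lemma size_substs [simp]: "size (substs A s) = size A"
  by (induction A arbitrary: s) (auto simp: Let_def)

lemma substs_id [simp]: "substs A id = A"
proof (induction A)
  case (All x A)
  have "id(x := x) = id" by (rule ext) simp
  moreover have "x \<notin> id ` (fv A - {x})" by simp
  ultimately show ?case using All by (simp add: Let_def del: id_apply image_id)
qed auto

lemma subst_simps [simp]:
  "subst (Rel i xs) y x = Rel i (map (id(x := y)) xs)"
  "subst (Eq u v) y x = Eq ((id(x := y)) u) ((id(x := y)) v)"
  "subst Bot y x = Bot"
  "subst (Imp A B) y x = Imp (subst A y x) (subst B y x)"
  "subst (Box A) y x = Box (subst A y x)"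
  by (auto simp: subst_def)

lemma subst_All [simp]:
  "y \<noteq> w \<Longrightarrow> subst (All w A) y x = All w (if w = x then A else subst A y x)"
proof -
  assume y: "y \<noteq> w"
  have "w \<notin> (id(x := y)) ` (fv A - {w})" using y by auto
  moreover have "(id(x := y))(w := w) = (if w = x then id else id(x := y))" by auto
  ultimately show ?thesis by (simp add: subst_def Let_def)
qed

lemma bv_subst: "y \<notin> bv A \<Longrightarrow> bv (subst A y x) = bv A"
  by (induction A) auto

lemma in_lang_subst [simp]: "in_lang_fm I (subst A y x) = in_lang_fm I A"
  by (simp add: subst_def)

lemma size_subst [simp]: "size (subst A y x) = size A"
  by (simp add: subst_def)

lemma alpha_fv: "alpha A B \<Longrightarrow> fv A = fv B"
  by (induction rule: alpha.induct) (auto simp: fv_subst)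

lemma alpha_in_lang: "alpha A B \<Longrightarrow> in_lang_fm I A = in_lang_fm I B"
  by (induction rule: alpha.induct) auto

section \<open>Renaming the free and bound variables of formulas\<close>

primrec rename :: "(var \<Rightarrow> var) \<Rightarrow> fm \<Rightarrow> fm" where
  "rename p (Rel i xs) = Rel i (map p xs)"
| "rename p (Eq x y) = Eq (p x) (p y)"
| "rename p Bot = Bot"
| "rename p (Imp A B) = Imp (rename p A) (rename p B)"
| "rename p (All x A) = All (p x) (rename p A)"
| "rename p (Box A) = Box (rename p A)"

lemma fv_rename: "inj_on p (fv A \<union> bv A) \<Longrightarrow> fv (rename p A) = p ` fv A"
proof (induction A)
  case (Imp A B)
  have "inj_on p (fv A \<union> bv A)" "inj_on p (fv B \<union> bv B)"
    by (rule inj_on_subset[OF Imp.prems], force)+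
  then show ?case using Imp.IH by auto
next
  case (All x A)
  have inj: "inj_on p (insert x (fv A \<union> bv A))"
    by (rule inj_on_subset[OF All.prems]) auto
  then have "p ` (fv A - {x}) = p ` fv A - p ` {x}"
    by (rule inj_on_image_set_diff) auto
  moreover have "fv (rename p A) = p ` fv A"
    by (rule All.IH[OF inj_on_subset[OF inj]]) auto
  ultimately show ?case by simp
qed auto

lemma bv_rename [simp]: "bv (rename p A) = p ` bv A"
  by (induction A) auto

lemma in_lang_rename [simp]: "in_lang_fm I (rename p A) = in_lang_fm I A"
  by (induction A) auto

lemma atomic_rename [simp]: "atomic (rename p A) = atomic A"
  by (induction A) auto

lemma rename_cong: "(\<And>v. v \<in> fv A \<union> bv A \<Longrightarrow> p v = q v) \<Longrightarrow> rename p A = rename q A"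
proof (induction A)
  case (All x A)
  have "p v = q v" if "v \<in> fv A \<union> bv A" for v
    using All.prems[of v] All.prems[of x] that by (cases "v = x") auto
  then show ?case using All by auto
qed auto

text \<open>As \<open>y\<close> is not bound in \<open>A\<close>, substitution is plain replacement
  and commutes with every renaming that keeps the variables involved apart. A name chosen by
  \<open>LEAST\<close> would not be preserved by \<open>p\<close>.\<close>

lemma rename_subst:
  "inj_on p (insert x (insert y (fv A \<union> bv A))) \<Longrightarrow> y \<notin> bv A \<Longrightarrow>
    rename p (subst A y x) = subst (rename p A) (p y) (p x)"
proof (induction A)
  case (Rel i xs)
  have "p v = p x \<longleftrightarrow> v = x" if "v \<in> set xs" for v
    by (rule inj_on_eq_iff[OF Rel.prems(1)]) (use that in auto)
  then show ?case by auto
next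
  case (Eq u v)
  have "p w = p x \<longleftrightarrow> w = x" if "w \<in> {u, v}" for w
    by (rule inj_on_eq_iff[OF Eq.prems(1)]) (use that in auto)
  then show ?case by auto
next
  case (Imp A B)
  have "inj_on p (insert x (insert y (fv A \<union> bv A)))"
      "inj_on p (insert x (insert y (fv B \<union> bv B)))"
    by (rule inj_on_subset[OF Imp.prems(1)], force)+
  then show ?case using Imp by auto
next
  case (All w A)
  have "p y = p w \<longleftrightarrow> y = w" "p w = p x \<longleftrightarrow> w = x"
    by (rule inj_on_eq_iff[OF All.prems(1)]; simp)+
  moreover have "inj_on p (insert x (insert y (fv A \<union> bv A)))"
    by (rule inj_on_subset[OF All.prems(1)]) auto
  ultimately show ?case using All by auto
qed auto

text \<open>In the quantifier case \<open>x\<close> may be free in the body and moved by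
  \<open>p\<close>, so the hypothesis does not apply to the body itself. It is applied to
  \<open>subst B y x\<close> with a new \<open>y\<close>, which is why the induction is on size; the
  formula and its renaming are then both variants of formulas quantified over
  \<open>y\<close>.\<close>

lemma alpha_rename_fixing_fv:
  "inj_on p (fv A \<union> bv A) \<Longrightarrow> (\<And>v. v \<in> fv A \<Longrightarrow> p v = v) \<Longrightarrow> alpha A (rename p A)"
proof (induction "size A" arbitrary: A p rule: less_induct)
  case less
  show ?case
  proof (cases A)
    case (Rel i xs)
    then have "map p xs = xs" using less.prems by (auto intro: map_idI)
    then show ?thesis using Rel by (simp add: alpha_refl)
  next
    case (Imp B C)
    have "alpha B (rename p B)" "alpha C (rename p C)"
      using less.prems Imp by (auto intro!: less.hyps elim!: inj_on_subset)
    then show ?thesis using Imp by (simp add: alpha_Imp)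
  next
    case (Box B)
    then show ?thesis using less by (simp add: alpha_Box)
  next
    case (All x B)
    let ?U = "insert x (fv B \<union> bv B)"
    have injU: "inj_on p ?U"
      by (rule inj_on_subset[OF less.prems(1)]) (auto simp: All)
    obtain y where y: "y \<notin> ?U \<union> p ` ?U"
      by (metis (no_types) ex_new_if_finite finite_Un finite_bv finite_fv finite_imageI
          finite_insert infinite_UNIV_nat)
    \<comment> \<open>\<open>y\<close> may be free in \<open>subst B y x\<close> and must be fixed
      there; on the variables of \<open>B\<close> and on \<open>x\<close>, \<open>q\<close> agrees
      with \<open>p\<close>.\<close>
    define q where "q = p(y := y)"
    have q: "q v = p v" if "v \<in> ?U" for v using that y by (auto simp: q_def)
    have injq: "inj_on q (insert y ?U)"
      using injU y unfolding q_def inj_on_def by auto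
    have "rename q (subst B y x) = subst (rename q B) (q y) (q x)"
      by (rule rename_subst) (use injq y in \<open>auto simp: insert_commute\<close>)
    also have "rename q B = rename p B" by (rule rename_cong) (use q in auto)
    also have "q y = y" by (simp add: q_def)
    also have "q x = p x" using q by auto
    finally have eq: "rename q (subst B y x) = subst (rename p B) y (p x)" .
    have "alpha (subst B y x) (rename q (subst B y x))"
    proof (rule less.hyps)
      show "size (subst B y x) < size A" using All by simp
      show "inj_on q (fv (subst B y x) \<union> bv (subst B y x))"
        by (rule inj_on_subset[OF injq]) (use y in \<open>auto simp: fv_subst bv_subst\<close>)
      show "q v = v" if "v \<in> fv (subst B y x)" for v
        using that less.prems(2) All by (auto simp: fv_subst q_def split: if_splits)
    qed
    then have "alpha (All y (subst B y x)) (All y (subst (rename p B) y (p x)))"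
      unfolding eq by (rule alpha_All)
    moreover have "alpha (All x B) (All y (subst B y x))"
      using y by (auto intro: alpha.alpha_rename)
    moreover have "y \<notin> fv (rename p B)"
      using y injU by (subst fv_rename) (auto elim!: inj_on_subset)
    then have "alpha (All (p x) (rename p B)) (All y (subst (rename p B) y (p x)))"
      by (rule alpha.alpha_rename)
    ultimately show ?thesis using All by (auto intro: alpha_trans alpha_sym)
  qed (use less.prems in \<open>auto simp: alpha_refl\<close>)
qed

section \<open>Renaming and variants of nested sequents\<close>

lemma free_vars_NS [simp]:
  "free_vars (NS X G D K) = set_mset X \<union> (\<Union>A\<in>set_mset G. fv A) \<union> (\<Union>A\<in>set_mset D. fv A)
     \<union> (\<Union>S\<in>set_mset K. free_vars S)"
  by (auto simp: free_vars_def)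

lemma bound_vars_NS [simp]:
  "bound_vars (NS X G D K) = (\<Union>A\<in>set_mset G. bv A) \<union> (\<Union>A\<in>set_mset D. bv A)
     \<union> (\<Union>S\<in>set_mset K. bound_vars S)"
  by (auto simp: bound_vars_def)

definition ren :: "(var \<Rightarrow> var) \<Rightarrow> nsequent \<Rightarrow> nsequent" where
  "ren p = map_nseq p (rename p)"

lemma ren_NS [simp]:
  "ren p (NS X G D K) =
     NS (image_mset p X) (image_mset (rename p) G) (image_mset (rename p) D) (image_mset (ren p) K)"
  by (simp add: ren_def)

lemma ren_sel [simp]:
  "sig (ren p S) = image_mset p (sig S)"
  "ant (ren p S) = image_mset (rename p) (ant S)"
  "suc (ren p S) = image_mset (rename p) (suc S)"
  "kids (ren p S) = image_mset (ren p) (kids S)"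
  by (cases S; simp)+

lemma fms_ren [simp]: "fms (ren p S) = rename p ` fms S"
  by (simp add: ren_def nseq.set_map)

lemma free_vars_ren: "inj p \<Longrightarrow> free_vars (ren p S) = p ` free_vars S"
  by (simp add: free_vars_def ren_def nseq.set_map fv_rename inj_on_subset[of p UNIV] image_Un image_UN)

lemma bound_vars_ren: "bound_vars (ren p S) = p ` bound_vars S"
  by (auto simp: bound_vars_def ren_def nseq.set_map)

lemma finite_sigvars_fms: "finite (sigvars S) \<and> finite (fms (S :: ('v, 'f) nseq))"
  by (induction S) auto

lemma finite_free_vars [simp]: "finite (free_vars S)"
  by (simp add: free_vars_def finite_sigvars_fms)

lemma finite_bound_vars [simp]: "finite (bound_vars S)"
  by (simp add: bound_vars_def finite_sigvars_fms)

lemma ren_cong: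
  assumes "\<And>v. v \<in> free_vars S \<union> bound_vars S \<Longrightarrow> p v = q v"
  shows "ren p S = ren q S"
  unfolding ren_def
proof (rule nseq.map_cong0)
  show "p v = q v" if "v \<in> sigvars S" for v using that assms by (auto simp: free_vars_def)
  show "rename p A = rename q A" if "A \<in> fms S" for A
    by (rule rename_cong) (use that assms in \<open>auto simp: free_vars_def bound_vars_def\<close>)
qed

lemma in_lang_ren: "in_lang I (ren p S) = in_lang I S"
  by (simp add: in_lang_def)

lemma variant_map:
  assumes "\<And>A. A \<in> fms S \<Longrightarrow> alpha A (f A)"
  shows "variant S (map_nseq id f S)"
  unfolding variant_def nseq.rel_map
  by (rule nseq.rel_refl_strong) (use assms in auto)

lemma variant_ren:
  assumes "inj p" "\<And>v. v \<in> free_vars S \<Longrightarrow> p v = v"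
  shows "variant S (ren p S)"
proof -
  have "ren p S = map_nseq id (rename p) S"
    unfolding ren_def by (rule nseq.map_cong0) (use assms in \<open>auto simp: free_vars_def\<close>)
  moreover have "alpha A (rename p A)" if "A \<in> fms S" for A
    by (rule alpha_rename_fixing_fv)
      (use assms that in \<open>auto simp: free_vars_def intro: inj_on_subset[OF assms(1)]\<close>)
  ultimately show ?thesis by (simp add: variant_map)
qed

lemma variant_trans: "variant S T \<Longrightarrow> variant T U \<Longrightarrow> variant S U"
proof -
  assume "variant S T" "variant T U"
  then have "rel_nseq ((=) OO (=)) (alpha OO alpha) S U"
    unfolding variant_def nseq.rel_compp by blast
  then show ?thesis
    unfolding variant_def by (rule nseq.rel_mono_strong) (auto intro: alpha_trans)
qed

lemma variant_free_vars: 
  assumes "variant S T" shows "free_vars S = free_vars T"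
proof -
  have "rel_set (=) (sigvars S) (sigvars T)"
    using assms unfolding variant_def by (rule rel_funD[OF nseq.set_transfer(1)])
  moreover have "rel_set alpha (fms S) (fms T)"
    using assms unfolding variant_def by (rule rel_funD[OF nseq.set_transfer(2)])
  then have "(\<Union>A\<in>fms S. fv A) = (\<Union>A\<in>fms T. fv A)"
    by (fastforce simp: rel_set_def dest: alpha_fv)
  ultimately show ?thesis by (simp add: free_vars_def rel_set_eq)
qed

lemma variant_in_lang: 
  assumes "variant S T" shows "in_lang I S = in_lang I T"
proof -
  have "rel_set alpha (fms S) (fms T)"
    using assms unfolding variant_def by (rule rel_funD[OF nseq.set_transfer(2)])
  then show ?thesis unfolding in_lang_def
    by (fastforce simp: rel_set_def dest: alpha_in_lang)
qed

text \<open>Extends a renaming upwards through a derivation: on \<open>S\<close> its values are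
  already settled, \<open>N\<close> are the variables to be moved, \<open>B\<close> the names in
  use.\<close>

lemma ex_inj_avoiding:
  fixes p :: "nat \<Rightarrow> nat"
  assumes "inj p" "finite S" "finite N" "N \<inter> S = {}" "finite B"
  shows "\<exists>q. inj q \<and> (\<forall>v\<in>S. q v = p v) \<and> q ` N \<inter> B = {}"
  using assms(3,4)
proof (induction N rule: finite_induct)
  case empty
  then show ?case using assms by auto
next
  case (insert v N)
  then obtain q where q: "inj q" "\<forall>v\<in>S. q v = p v" "q ` N \<inter> B = {}" by auto
  obtain w where w: "w \<notin> B \<union> q ` (S \<union> N)"
    by (metis ex_new_if_finite assms(2,5) insert.hyps(1) finite_Un finite_imageI infinite_UNIV_nat)
  \<comment> \<open>Neither \<open>w\<close> nor, by injectivity, \<open>q v\<close> is the image of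
    an element of \<open>S\<close> or \<open>N\<close>, so the swap leaves all earlier choices
    alone.\<close>
  let ?r = "Transposition.transpose (q v) w \<circ> q"
  have same: "?r u = q u" if "u \<in> S \<union> N" for u
  proof -
    have "q u \<noteq> q v" using q(1) insert that by (auto simp: inj_def)
    moreover have "q u \<noteq> w" using w that by auto
    ultimately show ?thesis by simp
  qed
  have "inj ?r" using q(1) by (auto intro: inj_compose)
  moreover have "?r v = w" by simp
  ultimately show ?case
    using same q w by (intro exI[of _ ?r]) (auto simp del: o_apply)
qed

section \<open>The weakening order\<close>

lemma rel_mset_impI:
  "(\<And>x y. R x y \<longrightarrow> R' x y) \<Longrightarrow> rel_mset R M N \<longrightarrow> rel_mset R' M N"
  using multiset.rel_mono_strong[of R M N R'] by blast

lemma rel_mset_memD: "rel_mset R M N \<Longrightarrow> a \<in># M \<Longrightarrow> \<exists>b\<in>#N. R a b"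
  using rel_funD[OF multiset.set_transfer] by (fastforce simp: rel_set_def)

lemma rel_mset_unionL:
  assumes "rel_mset R (M1 + M2) N"
  shows "\<exists>N1 N2. N = N1 + N2 \<and> rel_mset R M1 N1 \<and> rel_mset R M2 N2"
  using assms
proof (induction M1 arbitrary: N)
  case empty
  then show ?case by (intro exI[of _ "{#}"] exI[of _ N]) (simp add: rel_mset_Zero)
next
  case (add a M1)
  then obtain N' b where N: "N = add_mset b N'" "R a b" "rel_mset R (M1 + M2) N'"
    by (auto dest: msed_rel_invL)
  then obtain N1 N2 where "N' = N1 + N2" "rel_mset R M1 N1" "rel_mset R M2 N2"
    using add.IH by blast
  then show ?case using N
    by (intro exI[of _ "add_mset b N1"] exI[of _ N2]) (auto intro: rel_mset_Plus)
qed

lemma rel_mset_union: "rel_mset R M1 N1 \<Longrightarrow> rel_mset R M2 N2 \<Longrightarrow> rel_mset R (M1 + M2) (N1 + N2)"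
proof (induction M1 arbitrary: N1)
  case (add a M1)
  from add.prems(1) obtain N b where "N1 = add_mset b N" "R a b" "rel_mset R M1 N"
    by (auto dest: msed_rel_invL)
  with add show ?case by (simp add: rel_mset_Plus)
qed simp

text \<open>Reads an enlargement of filled subtrees back as an enlargement of the contexts they come
  from: the relation factors as a composition, whose middle multiset is \<open>K'\<close>.\<close>

lemma rel_mset_image_lift:
  assumes "rel_mset R (image_mset f K) M"
    and "\<And>c t. c \<in># K \<Longrightarrow> R (f c) t \<Longrightarrow> \<exists>c'. P c c' \<and> t = g c'"
  shows "\<exists>K'. rel_mset P K K' \<and> M = image_mset g K'"
proof -
  have "rel_mset (P OO (\<lambda>c' t. g c' = t)) K M"
    using assms(1) unfolding multiset.rel_map
    by (rule multiset.rel_mono_strong) (use assms(2) in blast)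
  then obtain K' where "rel_mset P K K'" "rel_mset (\<lambda>c' t. g c' = t) K' M"
    unfolding multiset.rel_compp by blast
  moreover then have "rel_mset (=) (image_mset g K') M"
    by (simp add: multiset.rel_map)
  ultimately show ?thesis by (auto simp: multiset.rel_eq)
qed

text \<open>\<open>K1\<close> is the part of \<open>K'\<close> hit by the embedding of the immediate
  subtrees; the rest of \<open>K'\<close> is new.\<close>

inductive le :: "('v, 'f) nseq \<Rightarrow> ('v, 'f) nseq \<Rightarrow> bool" where
  le_NS: "X \<subseteq># X' \<Longrightarrow> G \<subseteq># G' \<Longrightarrow> D \<subseteq># D' \<Longrightarrow> rel_mset le K K1 \<Longrightarrow> K1 \<subseteq># K' \<Longrightarrow>
    le (NS X G D K) (NS X' G' D' K')"
monos rel_mset_impI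

inductive_cases le_NSE: "le (NS X G D K) T"

lemma le_refl [simp, intro]: "le S S"
proof (induction S)
  case (NS X G D K)
  then have "rel_mset le K K" by (intro multiset.rel_refl_strong)
  then show ?case by (intro le_NS) auto
qed

lemma le_sigvars: "le S T \<Longrightarrow> sigvars S \<subseteq> sigvars T"
proof (induction rule: le.induct)
  case (le_NS X X' G G' D D' K K1 K')
  have "\<exists>T\<in>#K'. sigvars S \<subseteq> sigvars T" if "S \<in># K" for S
    using rel_mset_memD[OF le_NS.IH that] le_NS.hyps by (auto dest: mset_subset_eqD)
  moreover have "set_mset X \<subseteq> set_mset X'" "set_mset G \<subseteq> set_mset G'" "set_mset D \<subseteq> set_mset D'"
    using le_NS.hyps by (auto dest: mset_subset_eqD)
  ultimately show ?case by fastforce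
qed

lemma le_fms: "le S T \<Longrightarrow> fms S \<subseteq> fms T"
proof (induction rule: le.induct)
  case (le_NS X X' G G' D D' K K1 K')
  have "\<exists>T\<in>#K'. fms S \<subseteq> fms T" if "S \<in># K" for S
    using rel_mset_memD[OF le_NS.IH that] le_NS.hyps by (auto dest: mset_subset_eqD)
  moreover have "set_mset X \<subseteq> set_mset X'" "set_mset G \<subseteq> set_mset G'" "set_mset D \<subseteq> set_mset D'"
    using le_NS.hyps by (auto dest: mset_subset_eqD)
  ultimately show ?case by fastforce
qed

section \<open>Contexts: their variables, their enlargement, and factoring through them\<close>

definition hole_names :: "nctx \<Rightarrow> nat set" where
  "hole_names C = fst ` set_mset (holes C)"

lemma hole_names_Ctx [simp]:
  "hole_names (Ctx X G D H K) = set_mset H \<union> (\<Union>C\<in>set_mset K. hole_names C)"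
  by (force simp: hole_names_def)

lemma is_ctx_hole_names: "is_ctx n C \<Longrightarrow> hole_names C = {..<n}"
  unfolding is_ctx_def hole_names_def
  by (metis atLeast_upt set_image_mset set_mset_mset)

lemma hole_names_1 [simp]: "is_ctx (Suc 0) C \<Longrightarrow> hole_names C = {0}"
  by (auto simp: is_ctx_hole_names)

lemma hole_names_2 [simp]: "is_ctx 2 C \<Longrightarrow> hole_names C = {0, 1}"
  by (auto simp: is_ctx_hole_names)

lemma fill_cong:
  "(\<And>h. h \<in> hole_names C \<Longrightarrow> Ss ! h = Ts ! h) \<Longrightarrow> fill C Ss = fill C Ts"
proof (induction C)
  case (Ctx X G D H K)
  have "fill C Ss = fill C Ts" if "C \<in># K" for C using Ctx that by auto
  moreover have "Ss ! h = Ts ! h" if "h \<in># H" for h using Ctx.prems that by simp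
  ultimately show ?case by (simp cong: image_mset_cong)
qed

primrec erase :: "nctx \<Rightarrow> nsequent" where
  "erase (Ctx X G D H K) = NS X G D (image_mset erase K)"

lemma nseq_vars_sel:
  "sigvars S = set_mset (sig S) \<union> (\<Union>T\<in>set_mset (kids S). sigvars T)"
  "fms S = set_mset (ant S) \<union> set_mset (suc S) \<union> (\<Union>T\<in>set_mset (kids S). fms T)"
  by (cases S; auto)+

lemma sigvars_fill: "sigvars (fill C Ss) = sigvars (erase C) \<union> (\<Union>h\<in>hole_names C. sigvars (Ss ! h))"
proof (induction C)
  case (Ctx X G D H K)
  have kids: "(\<Union>C\<in>set_mset K. sigvars (fill C Ss))
      = (\<Union>C\<in>set_mset K. sigvars (erase C)) \<union> (\<Union>C\<in>set_mset K. \<Union>h\<in>hole_names C. sigvars (Ss ! h))"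
    using Ctx by auto
  have node: "(\<Union>h\<in>set_mset H. sigvars (Ss ! h))
      = (\<Union>h\<in>set_mset H. set_mset (sig (Ss ! h)))
      \<union> (\<Union>h\<in>set_mset H. \<Union>T\<in>set_mset (kids (Ss ! h)). sigvars T)"
    unfolding nseq_vars_sel(1)[of "Ss ! _"] by blast
  show ?case by (simp add: UN_Un kids node) blast
qed

lemma fms_fill: "fms (fill C Ss) = fms (erase C) \<union> (\<Union>h\<in>hole_names C. fms (Ss ! h))"
proof (induction C)
  case (Ctx X G D H K)
  have kids: "(\<Union>C\<in>set_mset K. fms (fill C Ss))
      = (\<Union>C\<in>set_mset K. fms (erase C)) \<union> (\<Union>C\<in>set_mset K. \<Union>h\<in>hole_names C. fms (Ss ! h))"
    using Ctx by auto
  have node: "(\<Union>h\<in>set_mset H. fms (Ss ! h))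
      = (\<Union>h\<in>set_mset H. set_mset (ant (Ss ! h)))
      \<union> (\<Union>h\<in>set_mset H. set_mset (suc (Ss ! h)))
      \<union> (\<Union>h\<in>set_mset H. \<Union>T\<in>set_mset (kids (Ss ! h)). fms T)"
    unfolding nseq_vars_sel(2)[of "Ss ! _"] by blast
  show ?case by (simp add: UN_Un kids node) blast
qed

lemma free_vars_fill [simp]:
  "free_vars (fill C Ss) = free_vars (erase C) \<union> (\<Union>h\<in>hole_names C. free_vars (Ss ! h))"
  by (auto simp: free_vars_def sigvars_fill fms_fill)

lemma bound_vars_fill [simp]:
  "bound_vars (fill C Ss) = bound_vars (erase C) \<union> (\<Union>h\<in>hole_names C. bound_vars (Ss ! h))"
  by (auto simp: bound_vars_def fms_fill)

text \<open>Enlarges a context without touching its holes: \<open>H\<close> stays and new subtrees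
  have none. Names and depths of holes survive, and with them the side conditions of
  \<open>R5\<close> and \<open>R5dom\<close>.\<close>

inductive ctx_le :: "nctx \<Rightarrow> nctx \<Rightarrow> bool" where
  ctx_le_Ctx: "X \<subseteq># X' \<Longrightarrow> G \<subseteq># G' \<Longrightarrow> D \<subseteq># D' \<Longrightarrow> rel_mset ctx_le K K1 \<Longrightarrow>
    (\<forall>C\<in>#K2. holes C = {#}) \<Longrightarrow> ctx_le (Ctx X G D H K) (Ctx X' G' D' H (K1 + K2))"
monos rel_mset_impI

lemma ctx_le_holes: "ctx_le C C' \<Longrightarrow> holes C' = holes C"
proof (induction rule: ctx_le.induct)
  case (ctx_le_Ctx X X' G G' D D' K K1 K2 H)
  have "rel_mset (\<lambda>C C'. holes C = holes C') K K1"
    using ctx_le_Ctx.IH by (rule multiset.rel_mono_strong) auto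
  then have "rel_mset (=) (image_mset holes K) (image_mset holes K1)"
    unfolding multiset.rel_map .
  then have "image_mset holes K1 = image_mset holes K" by (simp add: multiset.rel_eq)
  moreover have "(\<Sum>C\<in>#image_mset holes K2. image_mset (map_prod id Suc) C) = {#}"
    using ctx_le_Ctx.hyps by (induction K2) auto
  ultimately show ?case by simp
qed

lemma ctx_le_refl: "ctx_le C C"
proof (induction C)
  case (Ctx X G D H K)
  then have "rel_mset ctx_le K K" by (intro multiset.rel_refl_strong)
  then show ?case using ctx_le_Ctx[of X X G G D D K K "{#}" H] by simp
qed

lemma sum_mset_subseteq:
  "(\<And>h. h \<in># H \<Longrightarrow> f h \<subseteq># g h) \<Longrightarrow> (\<Sum>h\<in>#H. f h) \<subseteq># (\<Sum>h\<in>#H. g h)"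
  by (induction H) (auto intro: subset_mset.add_mono)

lemma fill_le:
  "ctx_le C C' \<Longrightarrow> (\<And>h. h \<in> hole_names C \<Longrightarrow> le (Ss ! h) (Ts ! h)) \<Longrightarrow>
    le (fill C Ss) (fill C' Ts)"
proof (induction rule: ctx_le.induct)
  case (ctx_le_Ctx X X' G G' D D' K K1 K2 H)
  have sel: "sig S \<subseteq># sig T" "ant S \<subseteq># ant T" "suc S \<subseteq># suc T"
    "\<exists>M. rel_mset le (kids S) M \<and> M \<subseteq># kids T" if "le S T" for S T
    using that by (cases rule: le.cases; auto)+
  have le: "le (Ss ! h) (Ts ! h)" if "h \<in># H" for h using ctx_le_Ctx.prems that by simp
  then have "\<exists>M. rel_mset le (\<Sum>h\<in>#H. kids (Ss ! h)) M \<and> M \<subseteq># (\<Sum>h\<in>#H. kids (Ts ! h))"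
  proof (induction H)
    case (add h H)
    obtain M N where "rel_mset le (kids (Ss ! h)) M" "M \<subseteq># kids (Ts ! h)"
      "rel_mset le (\<Sum>h\<in>#H. kids (Ss ! h)) N" "N \<subseteq># (\<Sum>h\<in>#H. kids (Ts ! h))"
      using add sel(4)[of "Ss ! h" "Ts ! h"] by auto
    then show ?case
      by (intro exI[of _ "M + N"]) (auto intro: rel_mset_union subset_mset.add_mono)
  qed (auto intro: rel_mset_Zero)
  then obtain M where M: "rel_mset le (\<Sum>h\<in>#H. kids (Ss ! h)) M"
    "M \<subseteq># (\<Sum>h\<in>#H. kids (Ts ! h))" by blast
  have "rel_mset (\<lambda>C C'. le (fill C Ss) (fill C' Ts)) K K1"
    using ctx_le_Ctx.IH by (rule multiset.rel_mono_strong) (use ctx_le_Ctx.prems in auto)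
  then have "rel_mset le (image_mset (\<lambda>C. fill C Ss) K) (image_mset (\<lambda>C. fill C Ts) K1)"
    unfolding multiset.rel_map .
  note rel = rel_mset_union[OF M(1) this]
  have "(\<Sum>h\<in>#H. sig (Ss ! h)) \<subseteq># (\<Sum>h\<in>#H. sig (Ts ! h))"
    "(\<Sum>h\<in>#H. ant (Ss ! h)) \<subseteq># (\<Sum>h\<in>#H. ant (Ts ! h))"
    "(\<Sum>h\<in>#H. suc (Ss ! h)) \<subseteq># (\<Sum>h\<in>#H. suc (Ts ! h))"
    by (rule sum_mset_subseteq; rule sel; rule le; assumption)+
  then show ?case
    unfolding fill.simps image_mset_union
    using M(2) ctx_le_Ctx.hyps by (intro le_NS[OF _ _ _ rel] subset_mset.add_mono) auto
qed

text \<open>Turns the subtrees that are new in an enlarged sequent into subtrees of the enlarged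
  context.\<close>

primrec ctx_of :: "nsequent \<Rightarrow> nctx" where
  "ctx_of (NS X G D K) = Ctx X G D {#} (image_mset ctx_of K)"

lemma fill_ctx_of [simp]: "fill (ctx_of S) Ss = S"
  by (induction S) (auto simp: multiset.map_comp o_def intro: multiset.map_ident_strong)

lemma holes_ctx_of [simp]: "holes (ctx_of S) = {#}"
proof (induction S)
  case (NS X G D K)
  then have "image_mset (holes \<circ> ctx_of) K = image_mset (\<lambda>_. {#}) K"
    by (intro image_mset_cong) auto
  then show ?case by (simp add: multiset.map_comp o_def)
qed

lemma image_fill_ctx_of [simp]: "image_mset (\<lambda>C. fill C Ss) (image_mset ctx_of K) = K"
  by (simp add: multiset.map_comp o_def)

text \<open>Holes without displayed children are not touched: whatever is added at their nodes
  can be added to the context instead.\<close>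

lemma le_fill_no_kids:
  "le (fill C Ss) T \<Longrightarrow> (\<And>h. h \<in> hole_names C \<Longrightarrow> kids (Ss ! h) = {#}) \<Longrightarrow>
    \<exists>C'. ctx_le C C' \<and> T = fill C' Ss"
proof (induction C arbitrary: T)
  case (Ctx X G D H K)
  have "(\<Sum>h\<in>#H. kids (Ss ! h)) = {#}" using Ctx.prems(2) by simp
  with Ctx.prems(1) obtain X' G' D' K' M where T: "T = NS X' G' D' K'"
    and sub: "X + (\<Sum>h\<in>#H. sig (Ss ! h)) \<subseteq># X'" "G + (\<Sum>h\<in>#H. ant (Ss ! h)) \<subseteq># G'"
      "D + (\<Sum>h\<in>#H. suc (Ss ! h)) \<subseteq># D'" "M \<subseteq># K'"
    and rel: "rel_mset le (image_mset (\<lambda>C. fill C Ss) K) M"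
    by (auto elim!: le_NSE)
  from sub obtain X2 G2 D2 K2 where eqs:
    "X' = X + (\<Sum>h\<in>#H. sig (Ss ! h)) + X2" "G' = G + (\<Sum>h\<in>#H. ant (Ss ! h)) + G2"
    "D' = D + (\<Sum>h\<in>#H. suc (Ss ! h)) + D2" "K' = M + K2"
    by (meson mset_subset_eq_exists_conv)
  have "\<exists>K1. rel_mset ctx_le K K1 \<and> M = image_mset (\<lambda>C. fill C Ss) K1"
    using rel
  proof (rule rel_mset_image_lift)
    show "\<exists>C'. ctx_le C C' \<and> T = fill C' Ss" if "C \<in># K" "le (fill C Ss) T" for C T
      by (rule Ctx.IH[OF that]) (use that(1) Ctx.prems(2) in auto)
  qed
  then obtain K1 where K1: "rel_mset ctx_le K K1" "M = image_mset (\<lambda>C. fill C Ss) K1" by blast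
  have "ctx_le (Ctx X G D H K) (Ctx (X + X2) (G + G2) (D + D2) H (K1 + image_mset ctx_of K2))"
    using K1 by (intro ctx_le_Ctx) auto
  moreover have "T = fill (Ctx (X + X2) (G + G2) (D + D2) H (K1 + image_mset ctx_of K2)) Ss"
    using T eqs K1 \<open>(\<Sum>h\<in>#H. kids (Ss ! h)) = {#}\<close>
    by (simp add: ac_simps del: multiset.map_comp)
  ultimately show ?case by blast
qed

lemma fst_holes_Ctx:
  "image_mset fst (holes (Ctx X G D H K)) = H + (\<Sum>C\<in>#K. image_mset fst (holes C))"
proof -
  have "image_mset fst (\<Sum>C\<in>#K. image_mset (map_prod id Suc) (holes C))
      = (\<Sum>C\<in>#K. image_mset fst (holes C))"
    by (induction K) (auto simp: multiset.map_comp o_def)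
  then show ?thesis by (simp add: multiset.map_comp o_def)
qed

lemma sum_mset_singleD:
  "(\<Sum>C\<in>#K. f C) = {#a#} \<Longrightarrow>
    \<exists>C K'. K = add_mset C K' \<and> f C = {#a#} \<and> (\<Sum>C\<in>#K'. f C) = {#}"
proof (induction K)
  case (add C K)
  then have "f C = {#} \<and> (\<Sum>C\<in>#K. f C) = {#a#} \<or> f C = {#a#} \<and> (\<Sum>C\<in>#K. f C) = {#}"
    by (auto simp: union_is_single)
  then show ?case
  proof
    assume *: "f C = {#} \<and> (\<Sum>C\<in>#K. f C) = {#a#}"
    then obtain C' K' where "K = add_mset C' K'" "f C' = {#a#}" "(\<Sum>C\<in>#K'. f C) = {#}"
      using add.IH by blast
    then show ?thesis using *
      by (intro exI[of _ C'] exI[of _ "add_mset C K'"]) auto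
  qed auto
qed auto

text \<open>Subtrees without holes do not see the plugs, so these may be exchanged; this is needed
  because the hole of an enlarged sequent is filled with an enlarged plug.\<close>

lemma le_fill_hole_free:
  assumes "rel_mset le (image_mset (\<lambda>C. fill C Ss) K) M" "\<forall>C\<in>#K. holes C = {#}"
  shows "\<exists>K'. rel_mset ctx_le K K' \<and> M = image_mset (\<lambda>C. fill C Ts) K'"
  using assms(1)
proof (rule rel_mset_image_lift)
  fix C T assume "C \<in># K" "le (fill C Ss) T"
  moreover then have "hole_names C = {}" using assms(2) by (simp add: hole_names_def)
  moreover then have "fill C Ss = fill C Ts" by (intro fill_cong) simp
  ultimately show "\<exists>C'. ctx_le C C' \<and> T = fill C' Ts"
    using le_fill_no_kids[of C Ts T] by auto
qed

text \<open>All growth at the node of the hole is charged to the context; only growth inside the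
  children of the plug stays with the plug. The induction follows the hole, which is either at the
  root or in exactly one subtree.\<close>

lemma le_fill_one_hole:
  "le (fill C [S]) T \<Longrightarrow> image_mset fst (holes C) = {#0#} \<Longrightarrow>
    \<exists>C' S'. ctx_le C C' \<and> T = fill C' [S'] \<and>
      sig S' = sig S \<and> ant S' = ant S \<and> suc S' = suc S \<and> rel_mset le (kids S) (kids S')"
proof (induction C arbitrary: T)
  case (Ctx X G D H K)
  from Ctx.prems(2) have "H = {#0#} \<and> (\<Sum>C\<in>#K. image_mset fst (holes C)) = {#} \<or>
      H = {#} \<and> (\<Sum>C\<in>#K. image_mset fst (holes C)) = {#0#}"
    unfolding fst_holes_Ctx by (auto simp: union_is_single)
  then show ?case
  proof
    assume *: "H = {#0#} \<and> (\<Sum>C\<in>#K. image_mset fst (holes C)) = {#}"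
    with Ctx.prems(1) obtain X' G' D' K' M where T: "T = NS X' G' D' K'"
      and sub: "X + sig S \<subseteq># X'" "G + ant S \<subseteq># G'" "D + suc S \<subseteq># D'" "M \<subseteq># K'"
      and rel: "rel_mset le (kids S + image_mset (\<lambda>C. fill C [S]) K) M"
      by (auto elim!: le_NSE)
    from sub obtain X2 G2 D2 K2 where eqs:
      "X' = X + sig S + X2" "G' = G + ant S + G2" "D' = D + suc S + D2" "K' = M + K2"
      by (meson mset_subset_eq_exists_conv)
    \<comment> \<open>The children of the enlarged root fall into those matching children of the
      plug (\<open>M1\<close>), those matching subtrees of the context (\<open>M2\<close>), and new
      ones (\<open>K2\<close>).\<close>
    obtain M1 M2 where M: "M = M1 + M2" "rel_mset le (kids S) M1"
      "rel_mset le (image_mset (\<lambda>C. fill C [S]) K) M2"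
      using rel_mset_unionL[OF rel] by blast
    define S' where "S' = NS (sig S) (ant S) (suc S) M1"
    obtain K1 where K1: "rel_mset ctx_le K K1" "M2 = image_mset (\<lambda>C. fill C [S']) K1"
      using le_fill_hole_free[OF M(3), of "[S']"] * by auto
    have "ctx_le (Ctx X G D H K) (Ctx (X + X2) (G + G2) (D + D2) H (K1 + image_mset ctx_of K2))"
      using K1 by (intro ctx_le_Ctx) auto
    moreover have "T = fill (Ctx (X + X2) (G + G2) (D + D2) H (K1 + image_mset ctx_of K2)) [S']"
      using T eqs K1 M * by (simp add: S'_def ac_simps del: multiset.map_comp)
    moreover have "sig S' = sig S" "ant S' = ant S" "suc S' = suc S" "rel_mset le (kids S) (kids S')"
      using M(2) by (simp_all add: S'_def)
    ultimately show ?thesis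
      by (intro exI[of _ "Ctx (X + X2) (G + G2) (D + D2) H (K1 + image_mset ctx_of K2)"]
          exI[of _ S'] conjI)
  next
    assume *: "H = {#} \<and> (\<Sum>C\<in>#K. image_mset fst (holes C)) = {#0#}"
    then obtain C K0 where K: "K = add_mset C K0" "image_mset fst (holes C) = {#0#}"
      "(\<Sum>C\<in>#K0. image_mset fst (holes C)) = {#}"
      using sum_mset_singleD[of "\<lambda>C. image_mset fst (holes C)" K 0] by auto
    from Ctx.prems(1) * K(1) obtain X' G' D' K' M where T: "T = NS X' G' D' K'"
      and sub: "X \<subseteq># X'" "G \<subseteq># G'" "D \<subseteq># D'" "M \<subseteq># K'"
      and rel: "rel_mset le (add_mset (fill C [S]) (image_mset (\<lambda>C. fill C [S]) K0)) M"
      by (auto elim!: le_NSE)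
    from sub obtain K2 where eqs: "K' = M + K2"
      by (meson mset_subset_eq_exists_conv)
    obtain T1 M2 where M: "M = add_mset T1 M2" "le (fill C [S]) T1"
      "rel_mset le (image_mset (\<lambda>C. fill C [S]) K0) M2"
      using msed_rel_invL[OF rel] by blast
    obtain C' S' where C': "ctx_le C C'" "T1 = fill C' [S']" "sig S' = sig S" "ant S' = ant S"
      "suc S' = suc S" "rel_mset le (kids S) (kids S')"
      using Ctx.IH[OF _ M(2) K(2)] K(1) by auto
    obtain K1 where K1: "rel_mset ctx_le K0 K1" "M2 = image_mset (\<lambda>C. fill C [S']) K1"
      using le_fill_hole_free[OF M(3), of "[S']"] K(3) by auto
    have "ctx_le (Ctx X G D H K) (Ctx X' G' D' H (add_mset C' K1 + image_mset ctx_of K2))"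
      using K K1 C' sub by (intro ctx_le_Ctx rel_mset_Plus) (auto intro: rel_mset_Plus)
    moreover have "T = fill (Ctx X' G' D' H (add_mset C' K1 + image_mset ctx_of K2)) [S']"
      using T eqs K1 M C' * by (simp add: ac_simps del: multiset.map_comp)
    ultimately show ?thesis using C'(3-6)
      by (intro exI[of _ "Ctx X' G' D' H (add_mset C' K1 + image_mset ctx_of K2)"]
          exI[of _ S'] conjI)
  qed
qed

section \<open>The rules\<close>

text \<open>\<open>T\<close> is the enlarged conclusion, \<open>S\<close> an old premiss and
  \<open>S'\<close> the new one. The upper bounds on \<open>S'\<close> are what its purity and its
  language are checked with.\<close>

definition grows :: "nsequent \<Rightarrow> nsequent \<Rightarrow> nsequent \<Rightarrow> bool" where
  "grows T S S' \<longleftrightarrow>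
     le S S' \<and> sigvars S' \<subseteq> sigvars T \<union> sigvars S \<and> fms S' \<subseteq> fms T \<union> fms S"

section \<open>Enlarging an inference from its conclusion\<close>

lemma weaken_no_kids:
  assumes "le (fill C Ss) T" "\<And>h. h \<in> hole_names C \<Longrightarrow> kids (Ss ! h) = {#}"
  obtains C' where "holes C' = holes C" "T = fill C' Ss" "\<And>Vs. grows T (fill C Vs) (fill C' Vs)"
proof -
  obtain C' where C': "ctx_le C C'" "T = fill C' Ss"
    using le_fill_no_kids assms by blast
  have "hole_names C' = hole_names C"
    using ctx_le_holes[OF C'(1)] by (simp add: hole_names_def)
  then have "grows T (fill C Vs) (fill C' Vs)" for Vs
    unfolding grows_def using fill_le[OF C'(1), of Vs Vs] C'(2) by (auto simp: sigvars_fill fms_fill)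
  then show ?thesis using that C' ctx_le_holes by blast
qed

lemma weaken_1:
  assumes "le (fill C [NS X G D {#}]) T" "is_ctx 1 C"
  obtains C' where "T = fill C' [NS X G D {#}]" "is_ctx 1 C'"
    "\<And>Vs. grows (fill C' [NS X G D {#}]) (fill C Vs) (fill C' Vs)"
proof -
  obtain C' where "holes C' = holes C" "T = fill C' [NS X G D {#}]"
    "\<And>Vs. grows T (fill C Vs) (fill C' Vs)"
    by (rule weaken_no_kids[OF assms(1)]) (use assms(2) in auto)
  then show ?thesis using assms(2) that[of C'] by (simp add: is_ctx_def)
qed

lemma weaken_2:
  assumes "le (fill C [NS X G D {#}, NS X' G' D' {#}]) T" "is_ctx 2 C"
  obtains C' where "T = fill C' [NS X G D {#}, NS X' G' D' {#}]" "is_ctx 2 C'"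
    "\<And>i k. depth_ge C i k \<Longrightarrow> depth_ge C' i k"
    "\<And>Vs. grows (fill C' [NS X G D {#}, NS X' G' D' {#}]) (fill C Vs) (fill C' Vs)"
proof -
  obtain C' where "holes C' = holes C" "T = fill C' [NS X G D {#}, NS X' G' D' {#}]"
    "\<And>Vs. grows T (fill C Vs) (fill C' Vs)"
    by (rule weaken_no_kids[OF assms(1)]) (use assms(2) in auto)
  then show ?thesis using assms(2) that[of C'] by (simp add: is_ctx_def depth_ge_def)
qed

text \<open>\<open>Y1\<close> and \<open>G1\<close> are what a premiss adds to the displayed child:
  a variable for \<open>Rcbf\<close>, a formula for \<open>LBox\<close> and \<open>R4\<close>,
  nothing for \<open>RB\<close> and \<open>Rbf\<close>. So one statement serves every rule that
  displays a child in its conclusion.\<close>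

lemma weaken_kid:
  assumes "le (fill C [NS X G D {#NS Y G' D' K#}]) T" "is_ctx 1 C"
  obtains C' Y2 G2 D2 K2 where "is_ctx 1 C'"
    "T = fill C' [NS X G D {#NS (Y + Y2) (G' + G2) (D' + D2) K2#}]"
    "\<And>X0 G0 D0 Y1 G1. grows T (fill C [NS X0 G0 D0 {#NS (Y1 + Y) (G1 + G') D' K#}])
       (fill C' [NS X0 G0 D0 {#NS (Y1 + (Y + Y2)) (G1 + (G' + G2)) (D' + D2) K2#}])"
proof -
  have "image_mset fst (holes C) = {#0#}" using assms(2) by (simp add: is_ctx_def)
  with le_fill_one_hole[OF assms(1)] obtain C' S' where C': "ctx_le C C'" "T = fill C' [S']"
    "sig S' = X" "ant S' = G" "suc S' = D" "rel_mset le {#NS Y G' D' K#} (kids S')"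
    by auto
  obtain N where N: "kids S' = {#N#}" "le (NS Y G' D' K) N"
    using C'(6) by (auto dest!: msed_rel_invL)
  then obtain Y' G'' D'' K2 M where N': "N = NS Y' G'' D'' K2" "Y \<subseteq># Y'" "G' \<subseteq># G''" "D' \<subseteq># D''"
    and M: "rel_mset le K M" "M \<subseteq># K2"
    by (auto elim: le_NSE)
  then obtain Y2 G2 D2 where "N = NS (Y + Y2) (G' + G2) (D' + D2) K2"
    by (metis mset_subset_eq_exists_conv)
  then have S': "S' = NS X G D {#NS (Y + Y2) (G' + G2) (D' + D2) K2#}"
    using C' N by (cases S') simp
  have C'1: "is_ctx 1 C'" using assms(2) ctx_le_holes[OF C'(1)] by (simp add: is_ctx_def)
  have "grows T (fill C [NS X0 G0 D0 {#NS (Y1 + Y) (G1 + G') D' K#}])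
       (fill C' [NS X0 G0 D0 {#NS (Y1 + (Y + Y2)) (G1 + (G' + G2)) (D' + D2) K2#}])"
    for X0 G0 D0 Y1 G1
  proof -
    have "le (NS (Y1 + Y) (G1 + G') D' K)
        (NS (Y1 + (Y + Y2)) (G1 + (G' + G2)) (D' + D2) K2)"
      by (rule le_NS[OF _ _ _ M]) (simp_all add: add.assoc[symmetric])
    then have "le (NS X0 G0 D0 {#NS (Y1 + Y) (G1 + G') D' K#})
        (NS X0 G0 D0 {#NS (Y1 + (Y + Y2)) (G1 + (G' + G2)) (D' + D2) K2#})"
      by (intro le_NS) (auto intro: rel_mset_Plus rel_mset_Zero)
    then show ?thesis unfolding grows_def
      using fill_le[OF C'(1)] assms(2) C'1 C'(2) S' by (auto simp: sigvars_fill fms_fill)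
  qed
  then show ?thesis using that C'1 C'(2) S' by blast
qed

text \<open>The enlarged conclusion still shows the principal part, so the same rule applies in the
  larger context. Only freshness of an eigenvariable can be lost and is therefore assumed.
  \<open>RBox\<close> and \<open>RD\<close> create their child in the premiss; their conclusions
  display none and need no special care.\<close>

lemma rule_weaken:
  "rule L e Ss S \<Longrightarrow> le S T \<Longrightarrow> (\<And>y. e = Some y \<Longrightarrow> y \<notin> free_vars T \<union> bound_vars T) \<Longrightarrow>
    \<exists>Ts. rule L e Ts T \<and> list_all2 (grows T) Ss Ts"
proof (induction rule: rule.induct)
  case (RAll C S X G D x A y)
  obtain C' where C': "T = fill C' [NS X G (D + {#All x A#}) {#}]" "is_ctx 1 C'"
    "\<And>Vs. grows T (fill C Vs) (fill C' Vs)"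
    using weaken_1[OF RAll.prems(1)[unfolded RAll(2)] RAll(1)] by metis
  have "rule L (Some y) [fill C' [NS (X + {#y#}) G (D + {#subst A y x#}) {#}]] T"
    by (rule rule.RAll[OF C'(2,1)]) (use RAll.prems(2) in auto)
  then show ?case using C'(3) by (intro exI conjI) auto
next
  case (LBox C X A G D Y G' D' K)
  show ?case
    apply (rule weaken_kid[OF LBox.prems(1)], rule LBox)
    subgoal premises C' for C' Y2 G2 D2 K2
      unfolding C'(2)
      by (rule exI, rule conjI, rule rule.LBox, (rule C' LBox)+,
          use C'(3)[of _ _ _ "{#}" "{#A#}"] C'(2) in \<open>simp add: ac_simps\<close>)
    done
next
  case (RB C X A G D Y G' D' K)
  show ?case
    apply (rule weaken_kid[OF RB.prems(1)], rule RB)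
    subgoal premises C' for C' Y2 G2 D2 K2
      \<comment> \<open>Here the child displays \<open>Box A\<close> already in the conclusion;
        reassociating puts the growth of its antecedent into the parameter of the rule.\<close>
      unfolding C'(2) add.assoc
      by (rule exI, rule conjI, rule rule.RB, (rule C' RB)+,
          use C'(3)[of _ _ _ "{#}" "{#}"] C'(2) in \<open>simp add: ac_simps\<close>)
    done
next
  case (R4 C X A G D Y G' D' K)
  show ?case
    apply (rule weaken_kid[OF R4.prems(1)], rule R4)
    subgoal premises C' for C' Y2 G2 D2 K2
      unfolding C'(2)
      by (rule exI, rule conjI, rule rule.R4, (rule C' R4)+,
          use C'(3)[of _ _ _ "{#}" "{#Box A#}"] C'(2) in \<open>simp add: ac_simps\<close>)
    done
next
  case (Rcbf C X x G D Y G' D' K)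
  show ?case
    apply (rule weaken_kid[OF Rcbf.prems(1)], rule Rcbf)
    subgoal premises C' for C' Y2 G2 D2 K2
      unfolding C'(2)
      by (rule exI, rule conjI, rule rule.Rcbf, (rule C' Rcbf)+,
          use C'(3)[of _ _ _ "{#x#}" "{#}"] C'(2) in \<open>simp add: ac_simps\<close>)
    done
next
  case (Rbf C X x G D Y G' D' K)
  show ?case
    apply (rule weaken_kid[OF Rbf.prems(1)], rule Rbf)
    subgoal premises C' for C' Y2 G2 D2 K2
    proof -
      have eq: "Y + {#x#} + Y2 = Y + Y2 + {#x#}" by simp
      show ?thesis
        unfolding C'(2) eq
        by (rule exI, rule conjI, rule rule.Rbf, (rule C' Rbf)+,
            use C'(3)[of _ _ _ "{#}" "{#}"] C'(2) in \<open>simp add: ac_simps\<close>)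
    qed
    done
qed (erule weaken_1 weaken_2, assumption, hypsubst, rule exI, rule conjI,
    (rule rule.intros; (assumption | blast)), blast intro: list.rel_intros)+

section \<open>Renaming an inference, and the variables of its premisses\<close>

primrec ren_ctx :: "(var \<Rightarrow> var) \<Rightarrow> nctx \<Rightarrow> nctx" where
  "ren_ctx p (Ctx X G D H K) =
     Ctx (image_mset p X) (image_mset (rename p) G) (image_mset (rename p) D) H
       (image_mset (ren_ctx p) K)"

lemma holes_ren_ctx [simp]: "holes (ren_ctx p C) = holes C"
proof (induction C)
  case (Ctx X G D H K)
  have "image_mset (holes \<circ> ren_ctx p) K = image_mset holes K"
    using Ctx by (intro image_mset_cong) simp
  then show ?case by (simp add: multiset.map_comp)
qed

lemma is_ctx_ren_ctx [simp]: "is_ctx n (ren_ctx p C) = is_ctx n C"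
  by (simp add: is_ctx_def)

lemma depth_ge_ren_ctx [simp]: "depth_ge (ren_ctx p C) i k = depth_ge C i k"
  by (simp add: depth_ge_def)

lemma image_mset_sum_mset: "image_mset f (\<Sum>h\<in>#H. g h) = (\<Sum>h\<in>#H. image_mset f (g h))"
  by (induction H) auto

lemma ren_fill:
  "hole_names C \<subseteq> {..<length Ss} \<Longrightarrow> ren p (fill C Ss) = fill (ren_ctx p C) (map (ren p) Ss)"
proof (induction C)
  case (Ctx X G D H K)
  have "ren p (fill C Ss) = fill (ren_ctx p C) (map (ren p) Ss)" if "C \<in># K" for C
    using Ctx that by auto
  then have "image_mset (\<lambda>C. ren p (fill C Ss)) K
      = image_mset (\<lambda>C. fill (ren_ctx p C) (map (ren p) Ss)) K"
    by (intro image_mset_cong)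
  moreover have "map (ren p) Ss ! h = ren p (Ss ! h)" if "h \<in># H" for h
    using Ctx.prems that by auto
  ultimately show ?case
    by (simp add: image_mset_sum_mset multiset.map_comp o_def cong: image_mset_cong)
qed

lemma ren_fill_1 [simp]: "is_ctx (Suc 0) C \<Longrightarrow> ren p (fill C [S]) = fill (ren_ctx p C) [ren p S]"
  by (simp add: ren_fill)

lemma ren_fill_2 [simp]:
  "is_ctx 2 C \<Longrightarrow> ren p (fill C [S, T]) = fill (ren_ctx p C) [ren p S, ren p T]"
  by (simp add: ren_fill)

lemma bv_atomic: "atomic P \<Longrightarrow> bv P = {}"
  by (cases P) auto

lemma rename_subst_inj:
  "inj p \<Longrightarrow> y \<notin> bv A \<Longrightarrow> rename p (subst A y x) = subst (rename p A) (p y) (p x)"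
  by (rule rename_subst, rule inj_on_subset[of _ UNIV]) auto

text \<open>Purity serves \<open>LAll\<close>: \<open>z\<close> stands in the signature and so is
  not bound in \<open>A\<close>. For \<open>RAll\<close> freshness gives the same, and for
  \<open>Repl\<close> atoms bind nothing.\<close>

lemma rule_ren:
  "rule L e Ss S \<Longrightarrow> inj p \<Longrightarrow> pure S \<Longrightarrow> rule L (map_option p e) (map (ren p) Ss) (ren p S)"
proof (induction rule: rule.induct)
  case (LAll C X z A x G D)
  then have "z \<notin> bv A" by (auto simp: pure_def)
  with LAll show ?case by (simp add: rename_subst_inj rule.intros[simplified])
next
  case (RAll C S X G D x A y)
  have y: "p y \<notin> free_vars (ren p S) \<union> bound_vars (ren p S)"
    unfolding free_vars_ren[OF RAll.prems(1)] bound_vars_ren image_Un[symmetric]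
      inj_image_mem_iff[OF RAll.prems(1)] by (rule RAll)
  have "y \<notin> bv A" using RAll by auto
  moreover have "rule L (Some (p y)) [fill (ren_ctx p C)
      [NS (image_mset p X + {#p y#}) (image_mset (rename p) G)
        (image_mset (rename p) D + {#subst (rename p A) (p y) (p x)#}) {#}]] (ren p S)"
    by (rule rule.RAll[OF _ _ y]) (use RAll in simp_all)
  ultimately show ?case using RAll by (simp add: rename_subst_inj)
next
  case (Repl C P X y z x G D)
  then show ?case by (simp add: rename_subst_inj bv_atomic rule.intros[simplified])
next
  case (Ref C X x G D)
  then show ?case using rule.Ref[of "ren_ctx p C" L "image_mset p X" "p x"] by simp
next
  case (Rui C X x G D)
  then show ?case using rule.Rui[of L "ren_ctx p C" "image_mset p X" "p x"] by simp
qed (simp_all add: rule.intros[simplified])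

text \<open>The rules that may bring in a free variable other than an eigenvariable,
  \<open>Ref\<close> and \<open>Rui\<close>, drop no formula and so lose no bound variable.\<close>

lemma rule_vars_cases:
  assumes "rule L e Ss S" "pure S" "T \<in> set Ss"
  shows "bound_vars T \<subseteq> bound_vars S \<and>
    (free_vars T \<subseteq> free_vars S \<union> set_option e \<or> bound_vars S \<subseteq> bound_vars T)"
  using assms
proof (induction rule: rule.induct)
  case (LAll C X z A x G D)
  then have z: "z \<notin> bv A" by (auto simp: pure_def)
  have "fv (subst A z x) \<subseteq> insert z (fv A - {x})" by (auto simp: fv_subst)
  then show ?case using LAll(1,3) bv_subst[OF z] by auto
next
  case (RAll C S X G D x A y)
  have y: "y \<notin> bv A" using RAll(1-3) by simp
  have "fv (subst A y x) \<subseteq> insert y (fv A - {x})" by (auto simp: fv_subst)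
  then show ?case using RAll(1,5) bv_subst[OF y] unfolding RAll(2) by auto
next
  case (Repl C P X y z x G D)
  have "bv (subst P y z) = {}" "bv (subst P x z) = {}" using Repl(2) by (simp_all add: bv_subst bv_atomic)
  moreover have "fv (subst P y z) \<subseteq> insert y (fv (subst P x z))" by (auto simp: fv_subst)
  ultimately show ?case using Repl(1,4) by auto
qed auto

text \<open>Stronger than purity of the premiss, since the conclusion may bind variables that the
  premiss has lost. The enlarged premiss may inherit them from the enlarged conclusion. Of the two
  alternatives above, the first is settled by purity of \<open>S\<close> and freshness of the
  eigenvariable, the second by purity of \<open>T\<close>.\<close>

lemma rule_vars:
  assumes "rule L e Ss S" "pure S" "T \<in> set Ss" "pure T"
  shows "bound_vars T \<subseteq> bound_vars S \<and> free_vars T \<inter> bound_vars S = {}"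
proof -
  have "set_option e \<inter> bound_vars S = {}"
    using assms(1) by (cases rule: rule.cases) auto
  with rule_vars_cases[OF assms(1-3)] assms(2,4) show ?thesis
    unfolding pure_def by blast
qed

lemma le_free_vars: "le S T \<Longrightarrow> free_vars S \<subseteq> free_vars T"
  unfolding free_vars_def using le_sigvars le_fms by fast

lemma le_bound_vars: "le S T \<Longrightarrow> bound_vars S \<subseteq> bound_vars T"
  unfolding bound_vars_def using le_fms by fast

lemma grows_vars:
  assumes "grows T S S'"
  shows "free_vars S' \<subseteq> free_vars T \<union> free_vars S" "bound_vars S' \<subseteq> bound_vars T \<union> bound_vars S"
    "in_lang I T \<Longrightarrow> in_lang I S \<Longrightarrow> in_lang I S'"
  using assms unfolding grows_def free_vars_def bound_vars_def in_lang_def by fast+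

section \<open>Weakening a derivation\<close>

text \<open>The conditions that can be checked node by node. Distinctness of eigenvariables concerns
  the whole tree and is established anew when the enlarged tree is built.\<close>

definition proper :: "(nat \<Rightarrow> nat set) \<Rightarrow> ax set \<Rightarrow> dtree \<Rightarrow> bool" where
  "proper I L D \<longleftrightarrow> built L D \<and> (\<forall>U\<in>sequents D. in_lang I U \<and> pure U)"

lemma concl_in_sequents: "concl D \<in> sequents D"
  by (cases D) simp

lemma built_Inf: "built L (Inf S e Ds) \<longleftrightarrow> rule L e (map concl Ds) S \<and> (\<forall>D\<in>set Ds. built L D)"
  by (auto intro: built.intros elim: built.cases)

lemma proper_Inf: "proper I L (Inf S e Ds) \<longleftrightarrow>
    rule L e (map concl Ds) S \<and> in_lang I S \<and> pure S \<and> (\<forall>D\<in>set Ds. proper I L D)"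
  by (auto simp: proper_def built_Inf)

lemma height_le_cong:
  assumes "list_all2 (\<lambda>D D'. height D' \<le> height D) Ds Ds'"
  shows "height (Inf S' e' Ds') \<le> height (Inf S e Ds)"
proof -
  have "height D' \<le> Max (insert 0 (set (map height Ds)))" if D': "D' \<in> set Ds'" for D'
  proof -
    obtain i where "i < length Ds'" "D' = Ds' ! i" using D' by (auto simp: in_set_conv_nth)
    then have "Ds ! i \<in> set Ds" "height D' \<le> height (Ds ! i)"
      using assms by (auto simp: list_all2_conv_all_nth)
    then show ?thesis by (auto intro!: Max_ge_iff[THEN iffD2])
  qed
  then show ?thesis by auto
qed

text \<open>The premisses are served one after another, each choice being added to the set to be
  avoided; hence \<open>V\<close> is quantified inside the assumption.\<close>

lemma choose_disjoint_derivations: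
  assumes "list_all2 (\<lambda>D T. \<forall>V. finite V \<longrightarrow> (\<exists>D'. concl D' = T \<and> proper I L D' \<and>
      height D' \<le> height D \<and> distinct (eigenvars D') \<and> set (eigenvars D') \<inter> V = {})) Ds Ts"
    and "finite V"
  shows "\<exists>Ds'. map concl Ds' = Ts \<and> (\<forall>D'\<in>set Ds'. proper I L D') \<and>
      list_all2 (\<lambda>D D'. height D' \<le> height D) Ds Ds' \<and>
      distinct (concat (map eigenvars Ds')) \<and> set (concat (map eigenvars Ds')) \<inter> V = {}"
  using assms
proof (induction Ds Ts arbitrary: V rule: list_all2_induct)
  case (Cons D Ds T Ts)
  obtain D' where D': "concl D' = T" "proper I L D'" "height D' \<le> height D"
    "distinct (eigenvars D')" "set (eigenvars D') \<inter> V = {}"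
    using Cons by blast
  obtain Ds' where "map concl Ds' = Ts" "\<forall>D'\<in>set Ds'. proper I L D'"
      "list_all2 (\<lambda>D D'. height D' \<le> height D) Ds Ds'"
      "distinct (concat (map eigenvars Ds'))"
      "set (concat (map eigenvars Ds')) \<inter> (V \<union> set (eigenvars D')) = {}"
    using Cons.IH[of "V \<union> set (eigenvars D')"] Cons.prems by auto
  with D' show ?case by (intro exI[of _ "D' # Ds'"]) auto
qed simp

text \<open>\<open>p\<close> is the renaming accumulated below this subtree, \<open>V\<close> holds
  names reserved elsewhere, in particular for eigenvariables outside the subtree. Each inference
  becomes one inference, so the height cannot grow.\<close>

lemma weaken_derivation:
  assumes "proper I L D" "inj p" "le (ren p (concl D)) T" "pure T" "in_lang I T" "finite V"
  shows "\<exists>D'. concl D' = T \<and> proper I L D' \<and> height D' \<le> height D \<and>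
      distinct (eigenvars D') \<and> set (eigenvars D') \<inter> V = {}"
  using assms
proof (induction D arbitrary: p T V)
  case (Inf S e Ds)
  let ?vars = "\<lambda>S. free_vars S \<union> bound_vars S"
  \<comment> \<open>Only these variables may be moved: on those of \<open>S\<close> the values of
    \<open>p\<close> are tied to \<open>T\<close> by the embedding.\<close>
  let ?N = "((\<Union>D\<in>set Ds. ?vars (concl D)) \<union> set_option e) - ?vars S"
  have rule: "rule L e (map concl Ds) S" and S: "in_lang I S" "pure S"
    and Ds: "\<And>D. D \<in> set Ds \<Longrightarrow> proper I L D"
    using Inf.prems(1) by (auto simp: proper_Inf)
  have pure_Ds: "pure (concl D)" "in_lang I (concl D)" if "D \<in> set Ds" for D
    using Ds[OF that] concl_in_sequents by (auto simp: proper_def)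
  have dis: "?N \<inter> ?vars S = {}" by blast
  have vars: "finite (?vars S)" and fin: "finite ?N" and bad: "finite (?vars T \<union> V)"
    using Inf.prems(6) by (cases e; simp)+
  obtain q where q: "inj q" "\<forall>v\<in>?vars S. q v = p v" "q ` ?N \<inter> (?vars T \<union> V) = {}"
    using ex_inj_avoiding[OF Inf.prems(2) vars fin dis bad] by blast
  have qS: "ren q S = ren p S" by (rule ren_cong) (use q(2) in blast)
  with Inf.prems have le: "le (ren q S) T" by simp
  have eig: "y \<notin> ?vars S" if "e = Some y" for y
    using rule that by (cases rule: rule.cases) auto
  have new: "q y \<notin> ?vars T \<union> V" if "e = Some y" for y
    using q(3) eig[OF that] that by auto
  obtain Ts where Ts: "rule L (map_option q e) Ts T"
    "list_all2 (grows T) (map (ren q) (map concl Ds)) Ts"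
    using rule_weaken[OF rule_ren[OF rule q(1) S(2)] le] new by auto
  have step: "pure T' \<and> in_lang I T'" if D: "D \<in> set Ds" and T': "grows T (ren q (concl D)) T'" for D T'
  proof -
    have vars: "bound_vars (concl D) \<subseteq> bound_vars S" "free_vars (concl D) \<inter> bound_vars S = {}"
      using rule_vars[OF rule S(2), of "concl D"] pure_Ds D by auto
    have "bound_vars (ren q (concl D)) \<subseteq> bound_vars (ren q S)"
      using vars by (auto simp: bound_vars_ren)
    then have bd: "bound_vars T' \<subseteq> bound_vars T"
      using grows_vars(2)[OF T'] le_bound_vars[OF le] by blast
    \<comment> \<open>Such a \<open>v\<close> is not bound in \<open>S\<close>. So either it is free
      in \<open>S\<close> and lands among the free variables of the pure \<open>T\<close>, or it is
      new and lands outside all variables of \<open>T\<close>.\<close>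
    have "q v \<notin> bound_vars T" if "v \<in> free_vars (concl D)" for v
    proof (cases "v \<in> free_vars S")
      case True
      then have "q v \<in> free_vars T"
        using le_free_vars[OF le] q(1) by (auto simp: free_vars_ren)
      then show ?thesis using Inf.prems(4) by (auto simp: pure_def)
    next
      case False
      then have "v \<in> ?N" using that vars D by auto
      then show ?thesis using q(3) by blast
    qed
    then have "free_vars T' \<inter> bound_vars T = {}"
      using grows_vars(1)[OF T'] Inf.prems(4) q(1) by (fastforce simp: pure_def free_vars_ren)
    moreover have "in_lang I T'"
      using grows_vars(3)[OF T'] Inf.prems(5) pure_Ds D by (simp add: in_lang_ren)
    ultimately show ?thesis using bd by (auto simp: pure_def)
  qed
  have "list_all2 (\<lambda>D T'. \<forall>V. finite V \<longrightarrow> (\<exists>D'. concl D' = T' \<and> proper I L D' \<and>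
      height D' \<le> height D \<and> distinct (eigenvars D') \<and> set (eigenvars D') \<inter> V = {})) Ds Ts"
    using Ts(2) unfolding list.rel_map
  proof (rule list.rel_mono_strong)
    fix D T' assume D: "D \<in> set Ds" and T': "grows T (ren q (concl D)) T'"
    have "le (ren q (concl D)) T'" using T' by (simp add: grows_def)
    then show "\<forall>V. finite V \<longrightarrow> (\<exists>D'. concl D' = T' \<and> proper I L D' \<and>
      height D' \<le> height D \<and> distinct (eigenvars D') \<and> set (eigenvars D') \<inter> V = {})"
      using Inf.IH[OF D Ds[OF D] q(1)] step[OF D T'] by blast
  qed
  \<comment> \<open>The eigenvariable of this inference is reserved too, so that it does not recur
    above.\<close>
  from choose_disjoint_derivations[OF this, of "V \<union> set_option (map_option q e)"]
  obtain Ds' where Ds': "map concl Ds' = Ts" "\<forall>D'\<in>set Ds'. proper I L D'"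
      "list_all2 (\<lambda>D D'. height D' \<le> height D) Ds Ds'"
      "distinct (concat (map eigenvars Ds'))"
      "set (concat (map eigenvars Ds')) \<inter> (V \<union> set_option (map_option q e)) = {}"
    using Inf.prems(6) by auto
  show ?case
  proof (intro exI[of _ "Inf T (map_option q e) Ds'"] conjI)
    show "proper I L (Inf T (map_option q e) Ds')"
      using Ts(1) Ds' Inf.prems by (simp add: proper_Inf)
    show "height (Inf T (map_option q e) Ds') \<le> height (Inf S e Ds)"
      using height_le_cong Ds'(3) by blast
    show "distinct (eigenvars (Inf T (map_option q e) Ds'))"
      using Ds' by (cases e) auto
    show "set (eigenvars (Inf T (map_option q e) Ds')) \<inter> V = {}"
      using Ds' new by (cases e) auto
  qed simp
qed

text \<open>Completes a square: formulas of \<open>T\<close> matched with formulas of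
  \<open>S\<close> are replaced by their counterparts in \<open>S'\<close>, the added ones by their
  images under \<open>f\<close>. \<open>P\<close> will say which bound variables are
  avoided.\<close>

lemma le_variant:
  assumes "le S T" "variant S S'" "\<And>A. A \<in> fms T \<Longrightarrow> alpha A (f A) \<and> P (f A)"
    "\<And>A. A \<in> fms S' \<Longrightarrow> P A"
  shows "\<exists>T'. variant T T' \<and> le S' T' \<and> (\<forall>A\<in>fms T'. P A)"
  using assms
proof (induction arbitrary: S' rule: le.induct)
  case (le_NS X X' G G' D D' K K1 K')
  obtain G1 D1 K2 where S': "S' = NS X G1 D1 K2"
    and rel: "rel_mset alpha G G1" "rel_mset alpha D D1" "rel_mset variant K K2"
    using le_NS.prems(1) unfolding variant_def by (cases S') (auto simp: multiset.rel_eq)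
  obtain GE DE KE where G': "G' = G + GE" and D': "D' = D + DE" and K': "K' = K1 + KE"
    using le_NS.hyps by (metis mset_subset_eq_exists_conv)
  let ?Q = "\<lambda>N N'. variant N N' \<and> (\<forall>A\<in>fms N'. P A)"
  have IH: "rel_mset (\<lambda>S T. \<forall>S'. ?Q S S' \<longrightarrow> (\<exists>T'. ?Q T T' \<and> le S' T')) K K1"
    using le_NS.IH
  proof (rule multiset.rel_mono_strong)
    fix S T assume T: "T \<in># K1"
      and "le S T \<and> (\<forall>S'. variant S S' \<longrightarrow> (\<forall>A. A \<in> fms T \<longrightarrow> alpha A (f A) \<and> P (f A)) \<longrightarrow>
          (\<forall>A. A \<in> fms S' \<longrightarrow> P A) \<longrightarrow> (\<exists>T'. variant T T' \<and> le S' T' \<and> (\<forall>A\<in>fms T'. P A)))"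
    moreover have "alpha A (f A) \<and> P (f A)" if "A \<in> fms T" for A
      using le_NS.prems(2)[of A] that T K' by auto
    ultimately show "\<forall>S'. ?Q S S' \<longrightarrow> (\<exists>T'. ?Q T T' \<and> le S' T')" by blast
  qed
  have "rel_mset ?Q K K2"
    using rel(3) by (rule multiset.rel_mono_strong) (use le_NS.prems(3) S' in auto)
  then have "rel_mset ?Q\<inverse>\<inverse> K2 K" unfolding multiset.rel_flip .
  \<comment> \<open>Going from \<open>K2\<close> back to \<open>K\<close> and up to
    \<open>K1\<close> is exchanged for an embedding of \<open>K2\<close> into some \<open>K3\<close>
    that consists of variants of \<open>K1\<close>.\<close>
  with IH have "rel_mset (?Q\<inverse>\<inverse> OO (\<lambda>S T. \<forall>S'. ?Q S S' \<longrightarrow> (\<exists>T'. ?Q T T' \<and> le S' T'))) K2 K1"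
    unfolding multiset.rel_compp by blast
  then have "rel_mset (le OO ?Q\<inverse>\<inverse>) K2 K1"
    by (rule multiset.rel_mono_strong) blast
  then obtain K3 where K3: "rel_mset le K2 K3" "rel_mset ?Q K1 K3"
    unfolding multiset.rel_compp relcompp_apply multiset.rel_flip by blast
  let ?N = "map_nseq id f"
  define T' where "T' = NS X' (G1 + image_mset f GE) (D1 + image_mset f DE) (K3 + image_mset ?N KE)"
  have refl: "rel_mset alpha M (image_mset f M)" if "set_mset M \<subseteq> fms (NS X' G' D' K')" for M
    unfolding multiset.rel_map by (rule multiset.rel_refl_strong) (use le_NS.prems(2) that in blast)
  have "rel_mset variant K1 K3" using K3(2) by (rule multiset.rel_mono_strong) auto
  moreover have "rel_mset variant KE (image_mset ?N KE)"
    unfolding multiset.rel_map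
    by (rule multiset.rel_refl_strong, rule variant_map) (use le_NS.prems(2) K' in auto)
  ultimately have "variant (NS X' G' D' K') T'"
    using rel_mset_union[OF rel(1) refl[of GE]] rel_mset_union[OF rel(2) refl[of DE]]
    unfolding T'_def variant_def by (auto simp: G' D' K' multiset.rel_eq rel_mset_union)
  moreover have "le S' T'"
    unfolding S' T'_def by (rule le.intros[OF _ _ _ K3(1)]) (use le_NS.hyps in auto)
  moreover have "P A" if A: "A \<in> fms T'" for A
  proof -
    have "P A" if "N \<in># K3" "A \<in> fms N" for N
      using rel_mset_memD[of "?Q\<inverse>\<inverse>" K3 K1] K3(2) that unfolding multiset.rel_flip by blast
    then show ?thesis
      using A le_NS.prems(2,3) unfolding T'_def S' G' D' K' by (auto simp: nseq.set_map)
  qed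
  ultimately show ?case by blast
qed

lemma ex_alpha_avoiding:
  "finite B \<Longrightarrow> \<exists>A'. alpha A A' \<and> bv A' \<inter> B = {}"
proof (induction "size A" arbitrary: A rule: less_induct)
  case less
  show ?case
  proof (cases A)
    case (Imp A1 A2)
    then obtain A1' A2' where "alpha A1 A1'" "bv A1' \<inter> B = {}" "alpha A2 A2'" "bv A2' \<inter> B = {}"
      using less.hyps[of A1] less.hyps[of A2] less.prems by auto
    then show ?thesis unfolding Imp by (intro exI[of _ "Imp A1' A2'"]) (auto intro: alpha_Imp)
  next
    case (All x A1)
    obtain y where y: "y \<notin> B \<union> fv A1"
      by (metis ex_new_if_finite finite_Un finite_fv infinite_UNIV_nat less.prems)
    obtain A' where "alpha (subst A1 y x) A'" "bv A' \<inter> B = {}"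
      using less.hyps[of "subst A1 y x"] less.prems All by auto
    moreover have "alpha (All x A1) (All y (subst A1 y x))"
      using y by (auto intro: alpha.alpha_rename)
    ultimately show ?thesis unfolding All using y
      by (intro exI[of _ "All y A'"]) (auto intro: alpha_trans alpha_All)
  next
    case (Box A1)
    then obtain A1' where "alpha A1 A1'" "bv A1' \<inter> B = {}"
      using less.hyps[of A1] less.prems by auto
    then show ?thesis unfolding Box by (intro exI[of _ "Box A1'"]) (auto intro: alpha_Box)
  qed (auto intro: alpha_refl exI[of _ A])
qed

lemma derivable_weaken:
  assumes "le S T" "in_lang I T" "derivable_le I L n S"
  shows "derivable_le I L n T"
proof -
  obtain S' D where D: "variant S S'" "concl D = S'" "proper I L D" "height D \<le> n"
    using assms(3) unfolding derivable_le_def derivation_def proper_def by auto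
  let ?F = "free_vars T"
  have S': "free_vars S' \<subseteq> ?F" "free_vars S' \<inter> bound_vars S' = {}"
    using le_free_vars[OF assms(1)] variant_free_vars[OF D(1)] D(2,3) concl_in_sequents
    by (auto simp: proper_def pure_def)
  \<comment> \<open>Purity of \<open>S'\<close> allows its bound variables to be moved while its
    free ones are fixed; the fixed ones keep the renamed root a variant.\<close>
  obtain p where p: "inj p" "\<forall>v\<in>free_vars S'. p v = v" "p ` bound_vars S' \<inter> ?F = {}"
    using ex_inj_avoiding[of id "free_vars S'" "bound_vars S'" ?F] S'(2) by (auto simp: inf_commute)
  have "\<forall>A. \<exists>A'. alpha A A' \<and> bv A' \<inter> ?F = {}" by (simp add: ex_alpha_avoiding)
  then obtain f where f: "\<forall>A. alpha A (f A) \<and> bv (f A) \<inter> ?F = {}"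
    using choice[of "\<lambda>A A'. alpha A A' \<and> bv A' \<inter> ?F = {}"] by blast
  have "variant S' (ren p S')" using p by (intro variant_ren) auto
  then have "variant S (ren p S')" using D(1) variant_trans by blast
  moreover have "bv A \<inter> ?F = {}" if "A \<in> fms (ren p S')" for A
    using p(3) that by (fastforce simp: bound_vars_def)
  ultimately obtain T' where T': "variant T T'" "le (ren p S') T'" "\<forall>A\<in>fms T'. bv A \<inter> ?F = {}"
    using le_variant[OF assms(1), where f = f and P = "\<lambda>A. bv A \<inter> ?F = {}"] f by blast
  \<comment> \<open>Variants share their free variables, so \<open>?F\<close> is also the set of
    free variables of \<open>T'\<close>.\<close>
  have "pure T'"
    using T'(3) variant_free_vars[OF T'(1)] by (auto simp: pure_def bound_vars_def)
  moreover have "in_lang I T'" using assms(2) variant_in_lang[OF T'(1)] by simp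
  ultimately obtain D' where "concl D' = T'" "proper I L D'" "height D' \<le> height D"
    "distinct (eigenvars D')"
    using weaken_derivation[OF D(3) p(1), of T' "{}"] T'(2) D(2) by auto
  then show ?thesis
    unfolding derivable_le_def derivation_def using T'(1) D(4)
    by (intro exI[of _ T'] exI[of _ D']) (auto simp: proper_def)
qed

lemma hp_admissible_le:
  assumes "\<And>Ss T. r Ss T \<Longrightarrow> \<exists>S\<in>set Ss. le S T"
  shows "hp_admissible I L r"
  unfolding hp_admissible_def
proof (intro allI impI)
  fix Ss T n
  assume "r Ss T" "\<forall>S\<in>set (T # Ss). in_lang I S" "\<forall>S\<in>set Ss. derivable_le I L n S"
  moreover from assms[OF this(1)] obtain S where "S \<in> set Ss" "le S T" by blast
  ultimately show "derivable_le I L n T" by (intro derivable_weaken[of S T]) auto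
qed

theorem lemma6:
  fixes L :: "ax set" and I :: "nat \<Rightarrow> nat set"
  assumes "properly_closed L"
  shows "hp_admissible I L IW \<and> hp_admissible I L EW"
proof (intro conjI hp_admissible_le)
  have fill: "le (fill C [S]) (fill C [T])" if "is_ctx 1 C" "le S T" for C S T
    by (rule fill_le[OF ctx_le_refl]) (use that in auto)
  fix Ss T
  show "\<exists>S\<in>set Ss. le S T" if "IW Ss T"
    using that
  proof cases
    case (1 C X G D P Q)
    have "le (NS X G D {#}) (NS X (P + G) (D + Q) {#})"
      by (rule le.intros[of _ _ _ _ _ _ _ "{#}"]) (auto intro: rel_mset_Zero)
    then show ?thesis using 1 fill by simp
  qed
  show "\<exists>S\<in>set Ss. le S T" if "EW Ss T"
    using that
  proof cases
    case (1 C X G D Y P Q)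
    have "le (NS X G D {#}) (NS X G D {#NS Y P Q {#}#})"
      by (rule le.intros[of _ _ _ _ _ _ _ "{#}"]) (auto intro: rel_mset_Zero)
    then show ?thesis using 1 fill by simp
  qed
qed

end
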